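(* Slices $\mathbb{H}^2\times\{z_0\}$, $z_0\in\mathbb{R}$, are the only p-translators and h-translators of rotational type in $\mathbb{H}^2\times\mathbb{R}$. That is, each slice $\mathbb{H}^2\times\{z_0\}$ is both a p-translator and an h-translator of rotational type, and every connected rotational surface that is a p-translator or an h-translator is (an open subset of) a slice $\mathbb{H}^2\times\{z_0\}$ for some $z_0\in\mathbb{R}$.
   Context: $\mathbb{H}^2\times\mathbb{R}$ is $\{(x,y,z)\in\mathbb{R}^3: y>0\}$ with metric $\frac{dx^2+dy^2}{y^2}+dz^2$. For an orientable immersed surface $\Sigma$ with unit normal $N$, $H$ denotes the mean curvature with respect to $N$, i.e. half the trace of the second fundamental form $\langle N,\overline\nabla_{\cdot}\,\cdot\rangle$. $\Sigma$ is a p-translator if $H=\langle N,\partial_x\rangle$, and an h-translator if $H=\langle N,x\partial_x+y\partial_y\rangle$. A surface is rotational (of rotational type) if it is a surface of revolution about a vertical geodesic $\{(x_0,y_0)\}\times\mathbb{R}$, i.e. it is invariant by the one-parameter group of isometries $(p,z)\mapsto(R_t(p),z)$, where $R_t$ are the hyperbolic rotations of $\mathbb{H}^2$ about $(x_0,y_0)$. *)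

theory Defs
  imports "HOL-Analysis.Analysis"
begin

section \<open>The ambient space\<close>

definition H2R :: "(real^3) set" where
  "H2R = {p. p $ 2 > 0}"

definition metric :: "real^3 \<Rightarrow> real^3 \<Rightarrow> real^3 \<Rightarrow> real" where
  "metric p v w = (v $ 1 * w $ 1 + v $ 2 * w $ 2) / (p $ 2)\<^sup>2 + v $ 3 * w $ 3"

definition slice :: "real \<Rightarrow> (real^3) set" where
  "slice z0 = {p \<in> H2R. p $ 3 = z0}"

definition partial_deriv :: "'n::finite \<Rightarrow> (real^'n \<Rightarrow> 'b::real_normed_vector) \<Rightarrow> real^'n \<Rightarrow> 'b" where
  "partial_deriv i F p = frechet_derivative F (at p) (axis i 1)"

definition gram :: "real^3 \<Rightarrow> real^3^3" where
  "gram p = (\<chi> i j. metric p (axis i 1) (axis j 1))"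

text \<open>The Christoffel symbols \<open>\<Gamma>\<^sup>k\<^sub>i\<^sub>j\<close> of the Levi-Civita connection of \<^const>\<open>metric\<close>.\<close>

definition christoffel :: "real^3 \<Rightarrow> 3 \<Rightarrow> 3 \<Rightarrow> 3 \<Rightarrow> real" where
  "christoffel p k i j =
     (\<Sum>l\<in>UNIV. matrix_inv (gram p) $ k $ l *
        (partial_deriv i (\<lambda>q. gram q $ j $ l) p + partial_deriv j (\<lambda>q. gram q $ i $ l) p
          - partial_deriv l (\<lambda>q. gram q $ i $ j) p)) / 2"

section \<open>Parametrized surfaces\<close>

text \<open>Iterated partial derivatives; meant for open \<open>D\<close> only, because \<^const>\<open>partial_deriv\<close> is
  the derivative in a full neighbourhood.\<close>

fun Ck_on :: "nat \<Rightarrow> (real^2) set \<Rightarrow> (real^2 \<Rightarrow> real^3) \<Rightarrow> bool" where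
  "Ck_on 0 D X \<longleftrightarrow> continuous_on D X"
| "Ck_on (Suc k) D X \<longleftrightarrow> X differentiable_on D \<and> (\<forall>i. Ck_on k D (partial_deriv i X))"

definition smooth_immersion_on :: "(real^2) set \<Rightarrow> (real^2 \<Rightarrow> real^3) \<Rightarrow> bool" where
  "smooth_immersion_on D X \<longleftrightarrow>
     (\<forall>k. Ck_on k D X) \<and> (\<forall>u\<in>D. inj (frechet_derivative X (at u)))"

text \<open>The ambient covariant derivative of \<open>\<partial>\<^sub>b X\<close> in the direction \<open>\<partial>\<^sub>a X\<close>.\<close>

definition cov_deriv :: "(real^2 \<Rightarrow> real^3) \<Rightarrow> 2 \<Rightarrow> 2 \<Rightarrow> real^2 \<Rightarrow> real^3" where
  "cov_deriv X a b u =
     partial_deriv a (partial_deriv b X) u +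
     (\<chi> k. \<Sum>i\<in>UNIV. \<Sum>j\<in>UNIV.
        christoffel (X u) k i j * partial_deriv a X u $ i * partial_deriv b X u $ j)"

definition first_form :: "(real^2 \<Rightarrow> real^3) \<Rightarrow> real^2 \<Rightarrow> real^2^2" where
  "first_form X u = (\<chi> a b. metric (X u) (partial_deriv a X u) (partial_deriv b X u))"

definition second_form :: "(real^2 \<Rightarrow> real^3) \<Rightarrow> real^3 \<Rightarrow> real^2 \<Rightarrow> real^2^2" where
  "second_form X n u = (\<chi> a b. metric (X u) n (cov_deriv X a b u))"

text \<open>Half the trace, with respect to the induced metric, of the second fundamental form
  for the normal \<open>n\<close> at \<open>X u\<close>.\<close>

definition mean_curvature :: "(real^2 \<Rightarrow> real^3) \<Rightarrow> real^3 \<Rightarrow> real^2 \<Rightarrow> real" where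
  "mean_curvature X n u = trace (matrix_inv (first_form X u) ** second_form X n u) / 2"

section \<open>Immersed surfaces\<close>

text \<open>An immersed surface is a topological surface \<open>M\<close> (Hausdorff, second countable) with a map
  \<open>f\<close> into the ambient space that becomes a smooth immersion in suitable charts
  (parametrizations \<open>\<phi> : D \<rightarrow> M\<close>) around every point.  No separate smooth atlas is needed:
  since immersions are local embeddings, any two charts in the sense below have smooth transition
  maps, so they form an atlas, and it is the only smooth structure for which \<open>f\<close> is an
  immersion.\<close>

definition surface_chart ::
    "'m topology \<Rightarrow> ('m \<Rightarrow> real^3) \<Rightarrow> (real^2) set \<Rightarrow> (real^2 \<Rightarrow> 'm) \<Rightarrow> bool" where
  "surface_chart M f D \<phi> \<longleftrightarrow>
     open D \<and> openin M (\<phi> ` D) \<and>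
     homeomorphic_map (top_of_set D) (subtopology M (\<phi> ` D)) \<phi> \<and>
     smooth_immersion_on D (f \<circ> \<phi>)"

definition immersed_surface :: "'m topology \<Rightarrow> ('m \<Rightarrow> real^3) \<Rightarrow> bool" where
  "immersed_surface M f \<longleftrightarrow>
     Hausdorff_space M \<and> second_countable M \<and> f ` topspace M \<subseteq> H2R \<and>
     (\<forall>p\<in>topspace M. \<exists>D \<phi>. surface_chart M f D \<phi> \<and> p \<in> \<phi> ` D)"

definition unit_normal :: "'m topology \<Rightarrow> ('m \<Rightarrow> real^3) \<Rightarrow> ('m \<Rightarrow> real^3) \<Rightarrow> bool" where
  "unit_normal M f N \<longleftrightarrow>
     continuous_map M euclidean N \<and>
     (\<forall>p\<in>topspace M. metric (f p) (N p) (N p) = 1) \<and>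
     (\<forall>D \<phi> u a. surface_chart M f D \<phi> \<and> u \<in> D \<longrightarrow>
        metric (f (\<phi> u)) (N (\<phi> u)) (partial_deriv a (f \<circ> \<phi>) u) = 0)"

section \<open>Translators and rotational surfaces\<close>

text \<open>Orientability is the existence of the unit normal \<open>N\<close>.  The mean curvature at a point does
  not depend on the chart in which it is computed.  Both sides of the equation change sign with
  \<open>N\<close>.\<close>

definition translator ::
    "(real^3 \<Rightarrow> real^3) \<Rightarrow> 'm topology \<Rightarrow> ('m \<Rightarrow> real^3) \<Rightarrow> bool" where
  "translator V M f \<longleftrightarrow>
     immersed_surface M f \<and>
     (\<exists>N. unit_normal M f N \<and>
        (\<forall>D \<phi> u. surface_chart M f D \<phi> \<and> u \<in> D \<longrightarrow>
           mean_curvature (f \<circ> \<phi>) (N (\<phi> u)) u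
             = metric (f (\<phi> u)) (N (\<phi> u)) (V (f (\<phi> u)))))"

definition p_translator :: "'m topology \<Rightarrow> ('m \<Rightarrow> real^3) \<Rightarrow> bool" where
  "p_translator = translator (\<lambda>p. axis 1 1)"

definition h_translator :: "'m topology \<Rightarrow> ('m \<Rightarrow> real^3) \<Rightarrow> bool" where
  "h_translator = translator (\<lambda>p. p $ 1 *\<^sub>R axis 1 1 + p $ 2 *\<^sub>R axis 2 1)"

text \<open>The hyperbolic rotation by the angle \<open>t\<close> about \<open>x0 + y0 \<i>\<close> in the upper half plane: the
  rotation \<open>\<zeta> \<mapsto> (cos (t/2) \<zeta> + sin (t/2)) / (cos (t/2) - sin (t/2) \<zeta>)\<close> about \<open>\<i>\<close>, conjugated by
  the isometry \<open>\<zeta> \<mapsto> x0 + y0 \<zeta>\<close>.\<close>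

definition hyp_rotation :: "real \<Rightarrow> real \<Rightarrow> real \<Rightarrow> complex \<Rightarrow> complex" where
  "hyp_rotation x0 y0 t w =
     (let \<zeta> = (w - of_real x0) / of_real y0; c = of_real (cos (t / 2)); s = of_real (sin (t / 2))
      in of_real x0 + of_real y0 * ((c * \<zeta> + s) / (c - s * \<zeta>)))"

definition vertical_rotation :: "real \<Rightarrow> real \<Rightarrow> real \<Rightarrow> real^3 \<Rightarrow> real^3" where
  "vertical_rotation x0 y0 t p =
     (let w = hyp_rotation x0 y0 t (Complex (p $ 1) (p $ 2)) in vector [Re w, Im w, p $ 3])"

definition rotational :: "'m topology \<Rightarrow> ('m \<Rightarrow> real^3) \<Rightarrow> bool" where
  "rotational M f \<longleftrightarrow>
     (\<exists>x0 y0. y0 > 0 \<and>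
        (\<forall>t. vertical_rotation x0 y0 t ` f ` topspace M = f ` topspace M))"

end

theory Submission
  imports Defs
begin

text \<open>
  A slice is totally geodesic and its unit normal is vertical, so for a horizontal field both sides
  of the translator equation are zero.  The converse rests on the symmetry of the mean curvature:
  it is constant along the orbits of a rotational surface, while the scalar product of the normal
  with the translating field oscillates along the orbits unless the normal is vertical.

  Rotations are assumed to preserve only the image of the surface, which may overlap itself.  The
  image has measure zero because the surface is second countable.  A piece transverse to the orbits
  would sweep out an open set under the rotations, so the surface is tangent to the rotation field
  everywhere (\<open>orbit_tangent\<close>).  In logarithmic polar coordinates about the axis
  (\<open>log_polar\<close>) a rotation is a translation of the imaginary part, and tangency says that the
  remaining two coordinates, radius and height, have rank one on the surface.  By the inverse
  function theorem they are then invariant under a translation of the third coordinate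
  (\<open>immersion_rank_one_shift\<close>), and small rotations lift to the domain of each chart
  (\<open>local_rotation_invariance\<close>).

  A chart composed with such a lift is again a chart, and its immersion is the rotated immersion.
  Since rotations are isometries (\<open>mean_curvature_rotation_comp\<close>), comparing the translator
  equation in the two charts shows that \<open>\<langle>N, A t\<rangle>\<close> is constant for small \<open>t\<close>, where \<open>N\<close> is the
  normal at one point and \<open>A t\<close> is the translating field pulled back by the rotation of angle \<open>t\<close>.
  For both fields of the theorem \<open>A t = K + cos t B + sin t C\<close> with \<open>B\<close> and \<open>C\<close> independent
  horizontal vectors (\<open>rotates_nontrivially\<close>), because neither is a rotation field.  Hence
  \<open>N\<close> is vertical off the axis (\<open>unit_normal_vertical_off_axis\<close>).  Off-axis points are
  dense in the surface, so the height is locally constant, and a connected surface lies in one slice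
  (\<open>rotational_translator_in_slice\<close>).
\<close>

section \<open>Partial derivatives and iterated differentiability\<close>

lemma partial_deriv_eq:
  assumes "(F has_derivative F') (at u)"
  shows "partial_deriv i F u = F' (axis i 1)"
  using frechet_derivative_at[OF assms] by (simp add: partial_deriv_def)

lemma has_derivative_frechet:
  assumes "F differentiable_on D" "open D" "u \<in> D"
  shows "(F has_derivative frechet_derivative F (at u)) (at u)"
  using assms differentiable_on_eq_differentiable_at frechet_derivative_works by blast

lemma frechet_derivative_cong_open:
  assumes "open D" "u \<in> D" "\<And>x. x \<in> D \<Longrightarrow> F x = G x"
  shows "frechet_derivative F (at u) = frechet_derivative G (at u)"
proof -
  have "(F has_derivative f') (at u) \<longleftrightarrow> (G has_derivative f') (at u)" for f'
    using has_derivative_transform_within_open[OF _ assms(1,2), of F f' UNIV G]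
      has_derivative_transform_within_open[OF _ assms(1,2), of G f' UNIV F] assms(3)
    by auto
  then show ?thesis by (simp add: frechet_derivative_def)
qed

lemma partial_deriv_cong_open:
  assumes "open D" "u \<in> D" "\<And>x. x \<in> D \<Longrightarrow> F x = G x"
  shows "partial_deriv i F u = partial_deriv i G u"
  using frechet_derivative_cong_open[OF assms] by (simp add: partial_deriv_def)

lemma linear_vec_expand:
  fixes L :: "real^'n \<Rightarrow> 'b::real_vector"
  assumes "linear L"
  shows "L v = (\<Sum>i\<in>UNIV. v $ i *\<^sub>R L (axis i 1))"
proof -
  have "v = (\<Sum>i\<in>UNIV. v $ i *\<^sub>R axis i 1)"
    by (simp add: vec_eq_iff axis_def if_distrib cong: if_cong)
  then have "L v = L (\<Sum>i\<in>UNIV. v $ i *\<^sub>R axis i 1)" by simp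
  also have "\<dots> = (\<Sum>i\<in>UNIV. v $ i *\<^sub>R L (axis i 1))"
    by (simp add: linear_sum[OF assms] linear_cmul[OF assms])
  finally show ?thesis .
qed

text \<open>The iterated differentiability of the surface charts, for values in an arbitrary normed space.  A
rotation acts on the complex coordinate of the half plane as a rational function, so smoothness of
a rotated chart is a matter of sums, products and inverses of complex-valued functions.\<close>

fun Ck :: "nat \<Rightarrow> (real^2) set \<Rightarrow> (real^2 \<Rightarrow> 'b::real_normed_vector) \<Rightarrow> bool" where
  "Ck 0 D F \<longleftrightarrow> continuous_on D F"
| "Ck (Suc k) D F \<longleftrightarrow> F differentiable_on D \<and> (\<forall>i. Ck k D (partial_deriv i F))"

lemma Ck_on_iff_Ck: "Ck_on k D X \<longleftrightarrow> Ck k D X"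
  by (induction k arbitrary: X) auto

text \<open>The partial derivatives of a function are unconstrained outside \<open>D\<close>, so every closure property
below first replaces the derivative of a compound function by the expected expression on \<open>D\<close>.\<close>

lemma Ck_cong:
  assumes "open D" "\<And>u. u \<in> D \<Longrightarrow> F u = G u" "Ck k D F"
  shows "Ck k D G"
  using assms(2,3)
proof (induction k arbitrary: F G)
  case 0
  then show ?case using continuous_on_cong[of D D F G] by simp
next
  case (Suc k)
  have "G differentiable_on D"
    using Suc.prems by (auto simp: differentiable_on_def intro: differentiable_transform_within[OF _ zero_less_one])
  moreover have "Ck k D (partial_deriv i G)" for i
  proof (rule Suc.IH)
    show "Ck k D (partial_deriv i F)" using Suc.prems by simp
    show "partial_deriv i F u = partial_deriv i G u" if "u \<in> D" for u
      by (rule partial_deriv_cong_open[OF assms(1) that Suc.prems(1)])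
  qed
  ultimately show ?case by simp
qed

lemma Ck_subset: "Ck k D F \<Longrightarrow> D' \<subseteq> D \<Longrightarrow> Ck k D' F"
  by (induction k arbitrary: F) (auto intro: continuous_on_subset differentiable_on_subset)

lemma Ck_Suc_imp_Ck: "Ck (Suc k) D F \<Longrightarrow> Ck k D F"
  by (induction k arbitrary: F) (auto intro: differentiable_imp_continuous_on)

lemma Ck_const: "Ck k D (\<lambda>_. c)"
proof (induction k arbitrary: c)
  case (Suc k)
  have "partial_deriv i (\<lambda>_. c) = (\<lambda>_. 0)" for i :: 2
    by (auto simp: partial_deriv_def)
  then show ?case using Suc by simp
qed auto

lemma Ck_linear:
  assumes "open D" "bounded_linear L" "Ck k D F"
  shows "Ck k D (\<lambda>u. L (F u))"
  using assms(3)
proof (induction k arbitrary: F)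
  case 0
  then show ?case using bounded_linear.continuous_on[OF assms(2)] by auto
next
  case (Suc k)
  note d = bounded_linear.has_derivative[OF assms(2) has_derivative_frechet[OF _ assms(1)]]
  have F: "F differentiable_on D" using Suc.prems by simp
  have "(\<lambda>u. L (F u)) differentiable_on D"
    using d[OF F] assms(1) differentiable_on_eq_differentiable_at differentiable_def by blast
  moreover have "Ck k D (partial_deriv i (\<lambda>u. L (F u)))" for i
  proof (rule Ck_cong[OF assms(1)])
    show "Ck k D (\<lambda>u. L (partial_deriv i F u))" using Suc by simp
    show "L (partial_deriv i F u) = partial_deriv i (\<lambda>u. L (F u)) u" if "u \<in> D" for u
      using partial_deriv_eq[OF d[OF F that]] by (simp add: partial_deriv_def)
  qed
  ultimately show ?case by simp
qed

lemma Ck_add: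
  assumes "open D" "Ck k D F" "Ck k D G"
  shows "Ck k D (\<lambda>u. F u + G u)"
  using assms(2,3)
proof (induction k arbitrary: F G)
  case 0
  then show ?case by (auto intro: continuous_on_add)
next
  case (Suc k)
  have "(\<lambda>u. F u + G u) differentiable_on D"
    using Suc.prems by (auto intro: differentiable_on_add)
  moreover have "Ck k D (partial_deriv i (\<lambda>u. F u + G u))" for i
  proof (rule Ck_cong[OF assms(1)])
    show "Ck k D (\<lambda>u. partial_deriv i F u + partial_deriv i G u)" using Suc by simp
    fix u assume u: "u \<in> D"
    show "partial_deriv i F u + partial_deriv i G u = partial_deriv i (\<lambda>u. F u + G u) u"
      using partial_deriv_eq[OF has_derivative_add[OF has_derivative_frechet[OF _ assms(1) u]
            has_derivative_frechet[OF _ assms(1) u]], of F G] Suc.prems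
      by (simp add: partial_deriv_def)
  qed
  ultimately show ?case by simp
qed

lemma Ck_mult:
  fixes F G :: "real^2 \<Rightarrow> 'b::real_normed_algebra"
  assumes "open D" "Ck k D F" "Ck k D G"
  shows "Ck k D (\<lambda>u. F u * G u)"
  using assms(2,3)
proof (induction k arbitrary: F G)
  case 0
  then show ?case by (auto intro: continuous_on_mult)
next
  case (Suc k)
  have FG: "Ck k D F" "Ck k D G" using Suc.prems Ck_Suc_imp_Ck by blast+
  have "(\<lambda>u. F u * G u) differentiable_on D"
    using Suc.prems by (auto simp: differentiable_on_def intro: differentiable_mult)
  moreover have "Ck k D (partial_deriv i (\<lambda>u. F u * G u))" for i
  proof (rule Ck_cong[OF assms(1)])
    show "Ck k D (\<lambda>u. F u * partial_deriv i G u + partial_deriv i F u * G u)"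
      using Suc FG by (intro Ck_add[OF assms(1)]) auto
    fix u assume u: "u \<in> D"
    show "F u * partial_deriv i G u + partial_deriv i F u * G u = partial_deriv i (\<lambda>u. F u * G u) u"
      using partial_deriv_eq[OF has_derivative_mult[OF has_derivative_frechet[OF _ assms(1) u]
            has_derivative_frechet[OF _ assms(1) u]], of F G] Suc.prems
      by (simp add: partial_deriv_def)
  qed
  ultimately show ?case by simp
qed

text \<open>The derivative \<open>- F' / F\<^sup>2\<close> again contains the inverse of \<open>F\<close>, but it needs one derivative fewer.\<close>

lemma Ck_inverse:
  fixes F :: "real^2 \<Rightarrow> 'b::real_normed_field"
  assumes "open D" "Ck k D F" "\<And>u. u \<in> D \<Longrightarrow> F u \<noteq> 0"
  shows "Ck k D (\<lambda>u. inverse (F u))"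
  using assms(2)
proof (induction k)
  case 0
  then show ?case using assms(3) by (auto intro: continuous_on_inverse)
next
  case (Suc k)
  have F: "F differentiable_on D" using Suc.prems by simp
  note d = Deriv.has_derivative_inverse[OF assms(3) has_derivative_frechet[OF F assms(1)]]
  have I: "Ck k D (\<lambda>u. inverse (F u))" using Suc Ck_Suc_imp_Ck by blast
  have "(\<lambda>u. inverse (F u)) differentiable_on D"
    using d assms(1) differentiable_on_eq_differentiable_at differentiable_def by blast
  moreover have "Ck k D (partial_deriv i (\<lambda>u. inverse (F u)))" for i
  proof (rule Ck_cong[OF assms(1)])
    show "Ck k D (\<lambda>u. (-1) * (inverse (F u) * partial_deriv i F u * inverse (F u)))"
      using Suc I by (intro Ck_mult[OF assms(1)] Ck_const) auto
    show "(-1) * (inverse (F u) * partial_deriv i F u * inverse (F u))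
        = partial_deriv i (\<lambda>u. inverse (F u)) u" if "u \<in> D" for u
      using partial_deriv_eq[OF d[OF that that]] by (simp add: partial_deriv_def)
  qed
  ultimately show ?case by simp
qed

text \<open>Continuous partial derivatives give a continuous Frechet derivative, which is the form of
  continuous differentiability that the inverse function theorem asks for.\<close>

lemma Ck_1_continuous_derivative:
  assumes "open D" "Ck 1 D F"
  shows "continuous_on D (\<lambda>u. Blinfun (frechet_derivative F (at u)))"
proof -
  have F: "F differentiable_on D" and c: "\<And>i. continuous_on D (partial_deriv i F)"
    using assms(2) by auto
  have ap: "blinfun_apply (Blinfun (frechet_derivative F (at u))) = frechet_derivative F (at u)"
    if "u \<in> D" for u
    using has_derivative_bounded_linear[OF has_derivative_frechet[OF F assms(1) that]]
    by (rule bounded_linear_Blinfun_apply)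
  show ?thesis
    unfolding continuous_on_eq_continuous_within
  proof (intro ballI continuous_blinfun_componentwiseI1)
    fix u and e :: "real^2" assume u: "u \<in> D" and e: "e \<in> Basis"
    then obtain i where i: "e = axis i 1" by (auto simp: Basis_vec_def)
    have "continuous_on D (\<lambda>x. blinfun_apply (Blinfun (frechet_derivative F (at x))) e)"
      using c[of i] ap by (simp add: i partial_deriv_def cong: continuous_on_cong_simp)
    then show "continuous (at u within D) (\<lambda>x. blinfun_apply (Blinfun (frechet_derivative F (at x))) e)"
      using u by (simp add: continuous_on_eq_continuous_within)
  qed
qed

section \<open>Hyperbolic rotations in complex notation\<close>

definition hpart :: "real^3 \<Rightarrow> complex" where
  "hpart p = Complex (p $ 1) (p $ 2)"

text \<open>A point or tangent vector is a complex number, its component along the half plane, together with a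
height.  Horizontal vectors have height \<open>0\<close>.\<close>

definition hpoint :: "complex \<Rightarrow> real \<Rightarrow> real^3" where
  "hpoint w z = vector [Re w, Im w, z]"

lemma hpart_sel [simp]: "Re (hpart p) = p $ 1" "Im (hpart p) = p $ 2"
  by (simp_all add: hpart_def)

lemma hpoint_nth [simp]: "hpoint w z $ 1 = Re w" "hpoint w z $ 2 = Im w" "hpoint w z $ 3 = z"
  by (simp_all add: hpoint_def)

lemma hpart_hpoint [simp]: "hpart (hpoint w z) = w"
  by (simp add: complex_eq_iff)

lemma hpoint_hpart [simp]: "hpoint (hpart p) (p $ 3) = p"
  by (simp add: vec_eq_iff forall_3)

lemma H2R_iff: "p \<in> H2R \<longleftrightarrow> Im (hpart p) > 0"
  by (simp add: H2R_def)

lemma bounded_linear_hpart [bounded_linear]: "bounded_linear hpart"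
  by (intro linear_conv_bounded_linear[THEN iffD1] linearI) (simp_all add: complex_eq_iff)

lemma bounded_linear_hpoint_horizontal: "bounded_linear (\<lambda>w. hpoint w 0)"
  by (intro linear_conv_bounded_linear[THEN iffD1] linearI) (simp_all add: vec_eq_iff forall_3)

lemma hpoint_eq: "hpoint w z = hpoint w 0 + z *\<^sub>R axis 3 1"
  by (simp add: vec_eq_iff forall_3 axis_def)

lemma metric_eq: "metric p v w = Re (hpart v * cnj (hpart w)) / (p $ 2)\<^sup>2 + v $ 3 * w $ 3"
  by (simp add: metric_def)

lemma vertical_rotation_eq:
  "vertical_rotation x0 y0 t p = hpoint (hyp_rotation x0 y0 t (hpart p)) (p $ 3)"
  by (simp add: vertical_rotation_def hpoint_def hpart_def Let_def)

text \<open>The denominator of the rotation as a Moebius map.  Its matrix has determinant \<open>1\<close>, so the derivative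
of the rotation is \<open>1 / rot_den\<^sup>2\<close>; this is why the denominator alone controls the metric and the
connection below.\<close>

definition rot_den :: "real \<Rightarrow> real \<Rightarrow> real \<Rightarrow> complex \<Rightarrow> complex" where
  "rot_den x0 y0 t w = of_real (cos (t / 2)) - of_real (sin (t / 2)) * ((w - of_real x0) / of_real y0)"

lemma rot_den_sel:
  "Re (rot_den x0 y0 t w) = cos (t/2) - sin (t/2) * ((Re w - x0) / y0)"
  "Im (rot_den x0 y0 t w) = - sin (t/2) * (Im w / y0)"
  by (simp_all add: rot_den_def)

lemma hyp_rotation_eq:
  "hyp_rotation x0 y0 t w =
    of_real x0 + of_real y0 *
      ((of_real (cos (t/2)) * ((w - of_real x0) / of_real y0) + of_real (sin (t/2))) / rot_den x0 y0 t w)"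
  by (simp add: hyp_rotation_def rot_den_def Let_def)

lemma rot_den_nonzero:
  assumes "y0 > 0" "Im w > 0"
  shows "rot_den x0 y0 t w \<noteq> 0"
proof
  assume *: "rot_den x0 y0 t w = 0"
  then have "Im (rot_den x0 y0 t w) = 0" "Re (rot_den x0 y0 t w) = 0" by simp_all
  then have "sin (t/2) = 0" "cos (t/2) = 0" using assms by (auto simp: rot_den_sel)
  then show False using sin_cos_squared_add[of "t/2"] by simp
qed

lemma rot_den_deriv:
  assumes "y0 > 0"
  shows "(rot_den x0 y0 t has_field_derivative - of_real (sin (t/2)) / of_real y0) (at w)"
  unfolding rot_den_def using assms by (auto intro!: derivative_eq_intros)

lemma sin_cos_squared_complex:
  "complex_of_real (cos a) ^ 2 + complex_of_real (sin a) ^ 2 = 1"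
  by (metis of_real_add of_real_power sin_cos_squared_add2 of_real_1)

lemma hyp_rotation_deriv:
  assumes "y0 > 0" "Im w > 0"
  shows "(hyp_rotation x0 y0 t has_field_derivative inverse (rot_den x0 y0 t w) ^ 2) (at w)"
proof -
  define c s \<zeta> d where "c = complex_of_real (cos (t/2))" and "s = complex_of_real (sin (t/2))"
    and "\<zeta> = (w - of_real x0) / of_real y0" and "d = rot_den x0 y0 t w"
  have d0: "d \<noteq> 0" using rot_den_nonzero[OF assms] by (simp add: d_def)
  have y: "complex_of_real y0 \<noteq> 0" using assms by simp
  have eq: "hyp_rotation x0 y0 t = (\<lambda>w. of_real x0 + of_real y0 *
      ((c * ((w - of_real x0) / of_real y0) + s) / rot_den x0 y0 t w))"
    by (simp add: hyp_rotation_eq c_def s_def fun_eq_iff)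
  have n: "((\<lambda>w. c * ((w - of_real x0) / of_real y0) + s) has_field_derivative c / of_real y0) (at w)"
    using y by (auto intro!: derivative_eq_intros)
  have "((\<lambda>w. (c * ((w - of_real x0) / of_real y0) + s) / rot_den x0 y0 t w) has_field_derivative
      (c / of_real y0 * d - (c * \<zeta> + s) * (- s / of_real y0)) / (d * d)) (at w)"
    using DERIV_divide[OF n rot_den_deriv[OF assms(1), of x0 t w]] d0
    by (simp add: d_def s_def \<zeta>_def)
  from DERIV_add[OF DERIV_const[of "of_real x0"] DERIV_cmult[OF this, of "of_real y0"]]
  have 1: "(hyp_rotation x0 y0 t has_field_derivative
      of_real y0 * ((c / of_real y0 * d - (c * \<zeta> + s) * (- s / of_real y0)) / (d * d))) (at w)"
    by (simp add: eq)
  have "c / of_real y0 * d - (c * \<zeta> + s) * (- s / of_real y0) = (c^2 + s^2) / of_real y0"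
  proof -
    have "d = c - s * \<zeta>" by (simp add: d_def rot_den_def c_def s_def \<zeta>_def)
    then have "c * d + (c * \<zeta> + s) * s = c^2 + s^2"
      by (simp only:) (simp add: algebra_simps power2_eq_square)
    then show ?thesis by (simp flip: add_divide_distrib)
  qed
  also have "c^2 + s^2 = 1" by (simp add: c_def s_def sin_cos_squared_complex)
  finally have "of_real y0 * ((c / of_real y0 * d - (c * \<zeta> + s) * (- s / of_real y0)) / (d * d))
      = inverse d ^ 2"
    using y d0 by (simp add: field_simps power2_eq_square)
  with 1 show ?thesis by (simp add: d_def)
qed

lemma Im_hyp_rotation:
  assumes "y0 > 0" "Im w > 0"
  shows "Im (hyp_rotation x0 y0 t w) = Im w / (norm (rot_den x0 y0 t w))\<^sup>2"
proof -
  define c s \<zeta> d where "c = cos (t/2)" and "s = sin (t/2)"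
    and "\<zeta> = (w - of_real x0) / of_real y0" and "d = rot_den x0 y0 t w"
  have d: "d = of_real c - of_real s * \<zeta>" by (simp add: d_def rot_den_def c_def s_def \<zeta>_def)
  have cs: "c^2 + s^2 = 1" by (simp add: c_def s_def)
  have "Im ((of_real c * \<zeta> + of_real s) / d) = Im ((of_real c * \<zeta> + of_real s) * cnj d) / (norm d)^2"
    by (subst complex_div_cnj) (simp flip: of_real_power)
  also have "Im ((of_real c * \<zeta> + of_real s) * cnj d) = (c^2 + s^2) * Im \<zeta>"
    by (simp add: d algebra_simps power2_eq_square)
  finally have "Im ((of_real c * \<zeta> + of_real s) / d) = Im \<zeta> / (norm d)^2" by (simp add: cs)
  moreover have "hyp_rotation x0 y0 t w = of_real x0 + of_real y0 * ((of_real c * \<zeta> + of_real s) / d)"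
    by (simp add: hyp_rotation_eq d_def \<zeta>_def c_def s_def)
  then have "Im (hyp_rotation x0 y0 t w) = y0 * Im ((of_real c * \<zeta> + of_real s) / d)"
    by (simp only: plus_complex.sel times_complex.sel Im_complex_of_real Re_complex_of_real)
  ultimately show ?thesis
    using assms by (simp add: d_def \<zeta>_def)
qed

lemma Im_hyp_rotation_pos:
  assumes "y0 > 0" "Im w > 0"
  shows "Im (hyp_rotation x0 y0 t w) > 0"
  using assms rot_den_nonzero[OF assms] by (simp add: Im_hyp_rotation)

text \<open>The Cayley transform to the Poincare disk centred at \<open>x0 + y0 \<i>\<close>.  It turns the hyperbolic
  rotations into Euclidean ones, so its modulus and argument are polar coordinates about the axis.\<close>

definition disk :: "real \<Rightarrow> real \<Rightarrow> complex \<Rightarrow> complex" where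
  "disk x0 y0 w = (w - Complex x0 y0) / (w - Complex x0 (- y0))"

lemma disk_den_nonzero:
  assumes "y0 > 0" "Im w > 0"
  shows "w - Complex x0 (- y0) \<noteq> 0"
  using assms by (auto simp: complex_eq_iff)

lemma disk_eq:
  assumes "y0 > 0"
  shows "disk x0 y0 w = ((w - of_real x0) / of_real y0 - \<i>) / ((w - of_real x0) / of_real y0 + \<i>)"
proof -
  define \<zeta> where "\<zeta> = (w - of_real x0) / of_real y0"
  have y: "complex_of_real y0 \<noteq> 0" using assms by simp
  have w: "w = of_real x0 + of_real y0 * \<zeta>" using y by (simp add: \<zeta>_def)
  have "w - Complex x0 y0 = of_real y0 * (\<zeta> - \<i>)" "w - Complex x0 (-y0) = of_real y0 * (\<zeta> + \<i>)"
    by (simp_all add: w complex_eq_iff algebra_simps)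
  then show ?thesis using y by (simp add: disk_def \<zeta>_def[symmetric])
qed

text \<open>The linear forms \<open>\<zeta> - \<i>\<close> and \<open>\<zeta> + \<i>\<close> are eigenvectors of the Moebius matrix of the rotation, with
eigenvalues \<open>cis (t/2)\<close> and \<open>cis (- t/2)\<close>, and the Cayley transform is their quotient.\<close>

lemma disk_hyp_rotation:
  assumes "y0 > 0" "Im w > 0"
  shows "disk x0 y0 (hyp_rotation x0 y0 t w) = cis t * disk x0 y0 w"
proof -
  define c s \<zeta> d where "c = complex_of_real (cos (t/2))" and "s = complex_of_real (sin (t/2))"
    and "\<zeta> = (w - of_real x0) / of_real y0" and "d = rot_den x0 y0 t w"
  have d0: "d \<noteq> 0" using rot_den_nonzero[OF assms] by (simp add: d_def)
  have y: "complex_of_real y0 \<noteq> 0" using assms by simp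
  have z0: "\<zeta> + \<i> \<noteq> 0"
  proof
    assume "\<zeta> + \<i> = 0"
    then have "Im (\<zeta> + \<i>) = 0" by simp
    moreover have "Im \<zeta> > 0" using assms by (simp add: \<zeta>_def)
    ultimately show False by simp
  qed
  have d: "d = c - s * \<zeta>" by (simp add: d_def rot_den_def c_def s_def \<zeta>_def)
  have cis2: "cis (t/2) = c + \<i> * s" "cis (-(t/2)) = c - \<i> * s"
    by (simp_all add: complex_eq_iff c_def s_def)
  have R: "(hyp_rotation x0 y0 t w - of_real x0) / of_real y0 = (c * \<zeta> + s) / d"
    using y by (simp add: hyp_rotation_eq c_def s_def \<zeta>_def d_def)
  have "disk x0 y0 (hyp_rotation x0 y0 t w) = ((c * \<zeta> + s) / d - \<i>) / ((c * \<zeta> + s) / d + \<i>)"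
    by (simp add: disk_eq[OF assms(1)] R)
  also have "\<dots> = ((c * \<zeta> + s) - \<i> * d) / ((c * \<zeta> + s) + \<i> * d)"
  proof -
    have "(c * \<zeta> + s) / d - \<i> = ((c * \<zeta> + s) - \<i> * d) / d" "(c * \<zeta> + s) / d + \<i> = ((c * \<zeta> + s) + \<i> * d) / d"
      using d0 by (simp_all add: field_simps)
    then show ?thesis using d0 by simp
  qed
  also have "(c * \<zeta> + s) - \<i> * d = cis (t/2) * (\<zeta> - \<i>)"
    by (simp add: d cis2 algebra_simps)
  also have "(c * \<zeta> + s) + \<i> * d = cis (-(t/2)) * (\<zeta> + \<i>)"
    by (simp add: d cis2 algebra_simps)
  also have "cis (t/2) * (\<zeta> - \<i>) / (cis (-(t/2)) * (\<zeta> + \<i>)) = cis t * ((\<zeta> - \<i>) / (\<zeta> + \<i>))"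
  proof -
    have "cis t = cis (t/2) / cis (-(t/2))" by (simp add: cis_divide)
    then show ?thesis by simp
  qed
  finally show ?thesis by (simp add: disk_eq[OF assms(1)] \<zeta>_def)
qed

lemma disk_inj:
  assumes "y0 > 0" "Im w > 0" "Im w' > 0" "disk x0 y0 w = disk x0 y0 w'"
  shows "w = w'"
proof -
  have "(w - Complex x0 y0) * (w' - Complex x0 (-y0)) = (w' - Complex x0 y0) * (w - Complex x0 (-y0))"
    using assms disk_den_nonzero[OF assms(1,2), of x0] disk_den_nonzero[OF assms(1,3), of x0]
    by (simp add: disk_def divide_simps del: right_minus_eq)
  then have "(w - w') * (Complex x0 y0 - Complex x0 (-y0)) = 0"
    by (simp add: algebra_simps)
  moreover have "Complex x0 y0 - Complex x0 (-y0) \<noteq> 0" using assms(1) by (simp add: complex_eq_iff)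
  ultimately show ?thesis by simp
qed

lemma disk_eq_0_iff:
  assumes "y0 > 0" "Im w > 0"
  shows "disk x0 y0 w = 0 \<longleftrightarrow> w = Complex x0 y0"
  using disk_den_nonzero[OF assms] by (simp add: disk_def)

lemma disk_deriv:
  assumes "y0 > 0" "Im w > 0"
  shows "(disk x0 y0 has_field_derivative 2 * \<i> * of_real y0 / (w - Complex x0 (- y0))\<^sup>2) (at w)"
proof -
  have eq: "disk x0 y0 = (\<lambda>w. (w - Complex x0 y0) / (w - Complex x0 (- y0)))"
    by (simp add: disk_def fun_eq_iff)
  have "1 * (w - Complex x0 (-y0)) - (w - Complex x0 y0) * 1 = 2 * \<i> * of_real y0"
    by (simp add: complex_eq_iff)
  then show ?thesis
    using DERIV_divide[of "\<lambda>w. w - Complex x0 y0" 1 w UNIV "\<lambda>w. w - Complex x0 (-y0)" 1]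
      disk_den_nonzero[OF assms, of x0]
    by (simp add: eq power2_eq_square) (auto intro!: derivative_eq_intros)
qed

text \<open>Since the disk coordinate is injective, two points at the same distance from the centre differ by
the rotation through the difference of their arguments.\<close>

lemma hyp_rotation_eqI:
  assumes "y0 > 0" "Im w > 0" "Im w' > 0" "disk x0 y0 w' = cis t * disk x0 y0 w"
  shows "w' = hyp_rotation x0 y0 t w"
  by (rule disk_inj[OF assms(1,3) Im_hyp_rotation_pos[OF assms(1,2)], of x0])
    (simp only: assms(4) disk_hyp_rotation[OF assms(1,2)])

text \<open>In complex notation the Levi-Civita connection of the half plane is
  \<open>\<nabla>\<^sub>a w\<^sub>b = w\<^sub>a\<^sub>b + (\<i> / Im w) w\<^sub>a w\<^sub>b\<close>.  A holomorphic map \<open>R\<close> preserves it iff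
  \<open>R'' + (\<i> / Im R) R'\<^sup>2 = R' (\<i> / Im w)\<close>, and this is that identity for a rotation.  After clearing
  denominators it says that \<open>d - cnj d = 2 \<i> Im d\<close> for the denominator \<open>d\<close>.\<close>

lemma hyp_rotation_connection:
  fixes x0 y0 t :: real and w :: complex
  assumes "y0 > 0" "Im w > 0"
  defines "m \<equiv> inverse (rot_den x0 y0 t w)"
  shows "2 * of_real (sin (t/2)) / of_real y0 * m ^ 3
           + \<i> / of_real (Im (hyp_rotation x0 y0 t w)) * (m ^ 2) ^ 2
         = m ^ 2 * (\<i> / of_real (Im w))"
proof -
  define d s where "d = rot_den x0 y0 t w" and "s = complex_of_real (sin (t/2))"
  have d0: "d \<noteq> 0" using rot_den_nonzero[OF assms(1,2)] by (simp add: d_def)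
  have y: "complex_of_real y0 \<noteq> 0" "complex_of_real (Im w) \<noteq> 0" using assms by simp_all
  define S Y where "S = 2 * s / of_real y0" and "Y = complex_of_real (Im w)"
  have Y: "Y \<noteq> 0" using y by (simp add: Y_def)
  have "d - cnj d = of_real (2 * Im d) * \<i>" by (rule complex_diff_cnj)
  also have "of_real (2 * Im d) = - S * Y"
    by (simp add: d_def rot_den_sel s_def S_def Y_def)
  finally have "\<i> * (d - cnj d) = \<i> * (- S * Y * \<i>)" by (simp only:)
  also have "\<dots> = S * Y" by (simp add: complex_eq_iff)
  finally have "\<i> * (d - cnj d) = S * Y" .
  then have key: "\<i> * cnj d + S * Y = \<i> * d"
    by (metis add.commute diff_add_cancel right_diff_distrib)
  have alg: "S * inverse d ^ 3 + \<i> / (Y / (d * e)) * (inverse d ^ 2) ^ 2 = (\<i> * e + S * Y) / (d ^ 3 * Y)" for e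
  proof -
    have "\<i> / (Y / (d * e)) * (inverse d ^ 2) ^ 2 = \<i> * e * inverse d ^ 3 * inverse Y * (d * inverse d)"
      by (simp only: divide_inverse inverse_mult_distrib inverse_inverse_eq power2_eq_square
          power3_eq_cube mult_ac)
    moreover have "S * inverse d ^ 3 = S * inverse d ^ 3 * (Y * inverse Y)" using Y by simp
    ultimately show ?thesis
      using d0 by (simp only: right_inverse[OF d0] divide_inverse inverse_mult_distrib power_inverse
          distrib_right distrib_left mult_ac mult_1_right add_ac mult_1_left)
  qed
  have "complex_of_real (Im (hyp_rotation x0 y0 t w)) = Y / (d * cnj d)"
    using complex_norm_square[of d] by (simp add: Im_hyp_rotation assms d_def Y_def)
  then have "2 * s / of_real y0 * m ^ 3 + \<i> / of_real (Im (hyp_rotation x0 y0 t w)) * (m ^ 2) ^ 2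
     = (\<i> * cnj d + S * Y) / (d ^ 3 * Y)"
    using alg[of "cnj d"] by (simp only: m_def d_def[symmetric] S_def[symmetric])
  also have "\<dots> = m ^ 2 * (\<i> / of_real (Im w))"
    using d0 Y by (simp add: key m_def d_def[symmetric] Y_def[symmetric] divide_simps power2_eq_square power3_eq_cube)
  finally show ?thesis by (simp add: s_def)
qed

section \<open>The Levi-Civita connection and its invariance under rotations\<close>

lemma vec_nth_has_derivative [derivative_intros]:
  "((\<lambda>x. x $ i) has_derivative (\<lambda>v. v $ i)) (at p within S)"
  by (rule bounded_linear_imp_has_derivative[OF bounded_linear_vec_nth])

lemma matrix_inv_eqI:
  fixes A :: "'a::semiring_1^'n^'m"
  assumes "A ** B = mat 1" "B ** A = mat 1"
  shows "matrix_inv A = B"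
proof -
  have "A ** matrix_inv A = mat 1 \<and> matrix_inv A ** A = mat 1"
    unfolding matrix_inv_def by (rule someI[of _ B]) (use assms in simp)
  then show ?thesis by (metis assms(1) matrix_mul_assoc matrix_mul_lid matrix_mul_rid)
qed

lemma gram_nth: "gram p $ i $ j = (if i = j then if i = 3 then 1 else 1 / (p $ 2)\<^sup>2 else 0)"
proof -
  have "\<forall>i j. gram p $ i $ j = (if i = j then if i = 3 then 1 else 1 / (p $ 2)\<^sup>2 else 0)"
    by (simp add: forall_3 gram_def metric_def axis_def)
  then show ?thesis by blast
qed

lemma matrix_inv_gram_nth:
  assumes "p $ 2 > 0"
  shows "matrix_inv (gram p) $ k $ l = (if k = l then if k = 3 then 1 else (p $ 2)\<^sup>2 else 0)"
proof -
  define B :: "real^3^3" where "B = (\<chi> k l. if k = l then if k = 3 then 1 else (p $ 2)\<^sup>2 else 0)"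
  have "gram p ** B = mat 1" "B ** gram p = mat 1"
    using assms by (simp_all add: vec_eq_iff matrix_matrix_mult_def forall_3 sum_3 gram_nth B_def mat_def)
  then have "matrix_inv (gram p) = B"
    by (rule matrix_inv_eqI)
  then show ?thesis by (simp add: B_def)
qed

lemma partial_deriv_gram:
  assumes "p $ 2 > 0"
  shows "partial_deriv i (\<lambda>q. gram q $ j $ l) p
    = (if j = l \<and> j \<noteq> 3 \<and> i = 2 then - 2 / (p $ 2) ^ 3 else 0)"
proof (cases "j = l \<and> j \<noteq> 3")
  case True
  have "((\<lambda>q::real^3. 1 / (q $ 2)\<^sup>2) has_derivative (\<lambda>v. - 2 * v $ 2 / (p $ 2) ^ 3)) (at p)"
    using assms by (auto intro!: derivative_eq_intros simp: power2_eq_square power3_eq_cube field_simps)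
  then show ?thesis using True by (auto simp: gram_nth axis_def partial_deriv_eq)
next
  case False
  then have "(\<lambda>q. gram q $ j $ l) = (\<lambda>q. if j = l then 1 else 0)" by (auto simp: gram_nth fun_eq_iff)
  then show ?thesis using False by (auto simp: partial_deriv_def)
qed

lemma christoffel_eq:
  assumes "p $ 2 > 0"
  shows "christoffel p k i j = matrix_inv (gram p) $ k $ k *
      (partial_deriv i (\<lambda>q. gram q $ j $ k) p + partial_deriv j (\<lambda>q. gram q $ i $ k) p
          - partial_deriv k (\<lambda>q. gram q $ i $ j) p) / 2"
  unfolding christoffel_def by (subst sum.remove[of _ k]) (auto simp: matrix_inv_gram_nth[OF assms])

lemma christoffel_values:
  assumes "p $ 2 > 0"
  shows "christoffel p k i j =
    (if k = 1 \<and> (i = 1 \<and> j = 2 \<or> i = 2 \<and> j = 1) \<or> k = 2 \<and> i = 2 \<and> j = 2 then - (1 / p $ 2)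
     else if k = 2 \<and> i = 1 \<and> j = 1 then 1 / p $ 2 else 0)"
proof -
  have y: "y\<^sup>2 * (2 / y ^ 3) = 2 / y" if "y \<noteq> 0" for y :: real
    using that by (simp add: power2_eq_square power3_eq_cube)
  have "\<forall>k i j. christoffel p k i j =
    (if k = 1 \<and> (i = 1 \<and> j = 2 \<or> i = 2 \<and> j = 1) \<or> k = 2 \<and> i = 2 \<and> j = 2 then - (1 / p $ 2)
     else if k = 2 \<and> i = 1 \<and> j = 1 then 1 / p $ 2 else 0)"
    using assms y[of "p $ 2"]
    unfolding forall_3 christoffel_eq[OF assms] matrix_inv_gram_nth[OF assms] partial_deriv_gram[OF assms]
    by simp
  then show ?thesis by blast
qed

text \<open>The four nonzero Christoffel symbols contribute the real and imaginary part of one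
complex product with \<open>\<i> / Im w\<close>.\<close>

lemma christoffel_term:
  assumes "p $ 2 > 0"
  shows "(\<chi> k. \<Sum>i\<in>UNIV. \<Sum>j\<in>UNIV. christoffel p k i j * v $ i * w $ j)
       = hpoint (\<i> / of_real (p $ 2) * hpart v * hpart w) 0"
proof -
  have i: "\<i> / of_real (p $ 2) = Complex 0 (1 / p $ 2)"
    by (simp add: complex_eq_iff Re_divide Im_divide power2_eq_square)
  show ?thesis
    unfolding vec_eq_iff forall_3 i
    by (simp add: sum_3 christoffel_values[OF assms] algebra_simps)
qed

lemma cov_deriv_eq:
  assumes "X u \<in> H2R"
  shows "cov_deriv X a b u = partial_deriv a (partial_deriv b X) u
     + hpoint (\<i> / of_real (X u $ 2) * hpart (partial_deriv a X u) * hpart (partial_deriv b X u)) 0"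
  using assms by (simp add: cov_deriv_def christoffel_term H2R_def)

definition rotation_diff :: "real \<Rightarrow> real \<Rightarrow> real \<Rightarrow> real^3 \<Rightarrow> real^3 \<Rightarrow> real^3" where
  "rotation_diff x0 y0 t p v = hpoint (inverse (rot_den x0 y0 t (hpart p)) ^ 2 * hpart v) (v $ 3)"

lemma vertical_rotation_has_derivative:
  assumes "y0 > 0" "p \<in> H2R"
  shows "(vertical_rotation x0 y0 t has_derivative rotation_diff x0 y0 t p) (at p)"
proof -
  have eq: "vertical_rotation x0 y0 t
      = (\<lambda>p. hpoint (hyp_rotation x0 y0 t (hpart p)) 0 + p $ 3 *\<^sub>R axis 3 1)"
    using vertical_rotation_eq hpoint_eq by metis
  have "((\<lambda>p. hyp_rotation x0 y0 t (hpart p)) has_derivative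
      (\<lambda>v. inverse (rot_den x0 y0 t (hpart p)) ^ 2 * hpart v)) (at p)"
    using has_derivative_compose[OF bounded_linear_imp_has_derivative[OF bounded_linear_hpart]
        hyp_rotation_deriv[OF assms(1), of "hpart p" x0 t, unfolded has_field_derivative_def]] assms(2)
    by (simp add: H2R_iff)
  from bounded_linear.has_derivative[OF bounded_linear_hpoint_horizontal this]
  have "(vertical_rotation x0 y0 t has_derivative
     (\<lambda>v. hpoint (inverse (rot_den x0 y0 t (hpart p)) ^ 2 * hpart v) 0 + v $ 3 *\<^sub>R axis 3 1)) (at p)"
    unfolding eq by (auto intro!: derivative_eq_intros)
  then show ?thesis by (simp flip: hpoint_eq add: rotation_diff_def[abs_def])
qed

text \<open>The derivative of the rotation has modulus \<open>1 / \<bar>d\<bar>\<^sup>2\<close>, the factor by which the rotation rescales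
the imaginary part.\<close>

lemma metric_rotation_diff:
  assumes "y0 > 0" "p \<in> H2R"
  shows "metric (vertical_rotation x0 y0 t p) (rotation_diff x0 y0 t p v) (rotation_diff x0 y0 t p w)
       = metric p v w"
proof -
  define d where "d = rot_den x0 y0 t (hpart p)"
  have d0: "d \<noteq> 0" using rot_den_nonzero assms by (simp add: d_def H2R_iff)
  define q where "q = inverse d ^ 2"
  have "q * cnj q = of_real ((norm q)^2)" by (rule complex_norm_square[symmetric])
  then have 1: "(q * hpart v) * cnj (q * hpart w) = of_real ((norm q)^2) * (hpart v * cnj (hpart w))"
    by (simp add: mult_ac)
  have 2: "norm q = 1 / (norm d)^2" by (simp add: q_def norm_power norm_divide norm_inverse field_simps)
  have im: "vertical_rotation x0 y0 t p $ 2 = p $ 2 / (norm d)^2"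
    using assms by (simp add: vertical_rotation_eq Im_hyp_rotation d_def H2R_iff)
  have "p $ 2 > 0" using assms by (simp add: H2R_def)
  then show ?thesis
    unfolding metric_eq im rotation_diff_def d_def[symmetric] q_def[symmetric] hpart_hpoint 1
      hpoint_nth
    using d0 by (simp add: 2 power_divide del: complex_mult_cnj)
qed

lemma vertical_rotation_in_H2R:
  assumes "y0 > 0" "p \<in> H2R" shows "vertical_rotation x0 y0 t p \<in> H2R"
  using assms Im_hyp_rotation_pos by (simp add: H2R_iff vertical_rotation_eq)

lemma rotation_diff_linear: "linear (rotation_diff x0 y0 t p)"
  by (intro linearI) (simp_all add: rotation_diff_def vec_eq_iff forall_3 complex_eq_iff algebra_simps)

lemma rotation_diff_inj:
  assumes "y0 > 0" "p \<in> H2R"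
  shows "inj (rotation_diff x0 y0 t p)"
proof -
  have d0: "rot_den x0 y0 t (hpart p) \<noteq> 0" using rot_den_nonzero assms by (simp add: H2R_iff)
  show ?thesis
    unfolding linear_injective_0[OF rotation_diff_linear]
  proof (intro allI impI)
    fix v assume "rotation_diff x0 y0 t p v = 0"
    then have "hpart (rotation_diff x0 y0 t p v) = 0" "rotation_diff x0 y0 t p v $ 3 = 0"
      by (simp_all add: complex_eq_iff)
    then have "hpart v = 0" "v $ 3 = 0" using d0 by (simp_all add: rotation_diff_def)
    then show "v = 0" by (simp add: vec_eq_iff forall_3 complex_eq_iff)
  qed
qed

section \<open>Mean curvature of a rotated immersion\<close>

lemma mean_curvature_cong_open:
  assumes U: "open U" "u \<in> U" and eq: "\<And>x. x \<in> U \<Longrightarrow> X x = Y x"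
  shows "mean_curvature X n u = mean_curvature Y n u"
proof -
  have 1: "partial_deriv a X x = partial_deriv a Y x" if "x \<in> U" for a x
    using partial_deriv_cong_open[OF U(1) that eq] .
  have 2: "partial_deriv a (partial_deriv b X) u = partial_deriv a (partial_deriv b Y) u" for a b
    using partial_deriv_cong_open[OF U 1] .
  have "first_form X u = first_form Y u" by (simp add: first_form_def 1[OF U(2)] eq[OF U(2)])
  moreover have "second_form X n u = second_form Y n u"
    by (simp add: second_form_def cov_deriv_def 1[OF U(2)] 2 eq[OF U(2)])
  ultimately show ?thesis by (simp add: mean_curvature_def)
qed

lemma mean_curvature_uminus: "mean_curvature X (- n) u = - mean_curvature X n u"
proof -
  have "second_form X (- n) u = - second_form X n u"
    by (simp add: second_form_def vec_eq_iff metric_def diff_divide_distrib add_divide_distrib)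
  then show ?thesis
    by (simp add: mean_curvature_def trace_def matrix_matrix_mult_def sum_negf)
qed

context
  fixes x0 y0 t :: real and U :: "(real^2) set" and X :: "real^2 \<Rightarrow> real^3"
  assumes y0: "y0 > 0" and U: "open U" and H: "X ` U \<subseteq> H2R"
begin

lemma rotation_comp_derivative:
  assumes "X differentiable_on U" "u \<in> U"
  shows "frechet_derivative (vertical_rotation x0 y0 t \<circ> X) (at u)
       = rotation_diff x0 y0 t (X u) \<circ> frechet_derivative X (at u)"
proof -
  have "X u \<in> H2R" using H assms(2) by blast
  from has_derivative_compose[OF has_derivative_frechet[OF assms(1) U assms(2)]
      vertical_rotation_has_derivative[OF y0 this, of x0 t]]
  show ?thesis using frechet_derivative_at by (fastforce simp: o_def)
qed

lemma rotation_comp_partial_deriv: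
  assumes "X differentiable_on U" "u \<in> U"
  shows "partial_deriv a (vertical_rotation x0 y0 t \<circ> X) u
       = rotation_diff x0 y0 t (X u) (partial_deriv a X u)"
  using rotation_comp_derivative[OF assms] by (simp add: partial_deriv_def)

lemma Ck_rotation_comp:
  assumes "Ck k U X"
  shows "Ck k U (vertical_rotation x0 y0 t \<circ> X)"
proof -
  have w: "Ck k U (\<lambda>u. hpart (X u))" by (rule Ck_linear[OF U bounded_linear_hpart assms])
  have z: "Ck k U (\<lambda>u. X u $ 3)" by (rule Ck_linear[OF U bounded_linear_vec_nth assms])
  have zeta: "Ck k U (\<lambda>u. (hpart (X u) + of_real (- x0)) * inverse (of_real y0))"
    by (intro Ck_mult Ck_add Ck_const U w)
  have den_eq: "rot_den x0 y0 t (hpart (X u)) = of_real (cos (t/2)) +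
      of_real (- sin (t/2)) * ((hpart (X u) + of_real (- x0)) * inverse (of_real y0))" for u
    by (simp only: rot_den_def divide_inverse of_real_minus add_uminus_conv_diff mult_minus_left)
  have den: "Ck k U (\<lambda>u. rot_den x0 y0 t (hpart (X u)))"
    unfolding den_eq by (intro Ck_mult Ck_add Ck_const U zeta)
  have inv: "Ck k U (\<lambda>u. inverse (rot_den x0 y0 t (hpart (X u))))"
    using H rot_den_nonzero[OF y0] by (intro Ck_inverse U den) (auto simp: H2R_iff)
  have eq: "hyp_rotation x0 y0 t (hpart (X u)) = of_real x0 + of_real y0 * ((of_real (cos (t/2)) *
       ((hpart (X u) + of_real (- x0)) * inverse (of_real y0)) + of_real (sin (t/2))) *
        inverse (rot_den x0 y0 t (hpart (X u))))" for u
    by (simp only: hyp_rotation_eq divide_inverse of_real_minus add_uminus_conv_diff)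
  have "Ck k U (\<lambda>u. hyp_rotation x0 y0 t (hpart (X u)))"
    unfolding eq by (intro Ck_mult Ck_add Ck_const U zeta inv)
  from Ck_add[OF U Ck_linear[OF U bounded_linear_hpoint_horizontal this]
      Ck_linear[OF U bounded_linear_scaleR_left[of "axis 3 1 :: real^3"] z]]
  have "Ck k U (\<lambda>u. hpoint (hyp_rotation x0 y0 t (hpart (X u))) (X u $ 3))"
    by (simp flip: hpoint_eq)
  then show ?thesis by (simp add: o_def vertical_rotation_eq[abs_def])
qed

lemma smooth_immersion_rotation_comp:
  assumes "smooth_immersion_on U X"
  shows "smooth_immersion_on U (vertical_rotation x0 y0 t \<circ> X)"
  unfolding smooth_immersion_on_def Ck_on_iff_Ck
proof (intro conjI allI ballI)
  show "Ck k U (vertical_rotation x0 y0 t \<circ> X)" for k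
    using assms by (intro Ck_rotation_comp) (simp add: smooth_immersion_on_def Ck_on_iff_Ck)
  fix u assume u: "u \<in> U"
  have "Ck_on 1 U X" using assms unfolding smooth_immersion_on_def by blast
  then have d: "X differentiable_on U" by simp
  have "X u \<in> H2R" using H u by blast
  then show "inj (frechet_derivative (vertical_rotation x0 y0 t \<circ> X) (at u))"
    unfolding rotation_comp_derivative[OF d u]
    using assms u rotation_diff_inj[OF y0]
    by (intro inj_compose) (auto simp: smooth_immersion_on_def)
qed

text \<open>The second derivative of the rotated chart has an extra term from the second derivative of the
  rotation.  It is exactly what the change of the connection coefficient compensates.\<close>

lemma cov_deriv_rotation_comp:
  assumes C: "Ck 2 U X" and u: "u \<in> U"
  shows "cov_deriv (vertical_rotation x0 y0 t \<circ> X) a b u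
       = rotation_diff x0 y0 t (X u) (cov_deriv X a b u)"
proof -
  have d: "X differentiable_on U" and db: "partial_deriv b X differentiable_on U"
    using C by (auto simp: numeral_2_eq_2)
  define m where "m = inverse (rot_den x0 y0 t (hpart (X u)))"
  define s where "s = 2 * of_real (sin (t/2)) / of_real y0 * m ^ 3"
  define xa xb xab where "xa = partial_deriv a X u" and "xb = partial_deriv b X u"
    and "xab = partial_deriv a (partial_deriv b X) u"
  have Xu: "X u \<in> H2R" using H u by blast
  have den: "rot_den x0 y0 t (hpart (X u)) \<noteq> 0" using Xu rot_den_nonzero[OF y0] by (simp add: H2R_iff)
  have "((\<lambda>w. inverse (rot_den x0 y0 t w) ^ 2) has_field_derivative s) (at (hpart (X u)))"
    using DERIV_power[OF DERIV_inverse'[OF rot_den_deriv[OF y0] den], of 2]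
    by (simp add: s_def m_def power2_eq_square power3_eq_cube mult_ac)
  then have m2: "((\<lambda>w. inverse (rot_den x0 y0 t w) ^ 2) has_derivative (\<lambda>h. s * h)) (at (hpart (X u)))"
    by (simp add: has_field_derivative_def)
  have dX: "(X has_derivative frechet_derivative X (at u)) (at u)"
    by (rule has_derivative_frechet[OF d U u])
  have dXb: "(partial_deriv b X has_derivative frechet_derivative (partial_deriv b X) (at u)) (at u)"
    by (rule has_derivative_frechet[OF db U u])
  have M: "((\<lambda>u. inverse (rot_den x0 y0 t (hpart (X u))) ^ 2) has_derivative
      (\<lambda>v. s * hpart (frechet_derivative X (at u) v))) (at u)"
    using has_derivative_compose[OF bounded_linear.has_derivative[OF bounded_linear_hpart dX] m2] .
  have "((\<lambda>u. inverse (rot_den x0 y0 t (hpart (X u))) ^ 2 * hpart (partial_deriv b X u)) has_derivative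
     (\<lambda>v. m ^ 2 * hpart (frechet_derivative (partial_deriv b X) (at u) v)
          + s * hpart (frechet_derivative X (at u) v) * hpart xb)) (at u)"
    using has_derivative_mult[OF M bounded_linear.has_derivative[OF bounded_linear_hpart dXb]]
    by (simp add: m_def xb_def)
  from has_derivative_add[OF bounded_linear.has_derivative[OF bounded_linear_hpoint_horizontal this]
      bounded_linear.has_derivative[OF bounded_linear_scaleR_left[of "axis 3 1 :: real^3"]
        bounded_linear.has_derivative[OF bounded_linear_vec_nth[of 3] dXb]]]
  have "((\<lambda>u. rotation_diff x0 y0 t (X u) (partial_deriv b X u)) has_derivative
     (\<lambda>v. hpoint (m ^ 2 * hpart (frechet_derivative (partial_deriv b X) (at u) v)
          + s * hpart (frechet_derivative X (at u) v) * hpart xb)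
          (frechet_derivative (partial_deriv b X) (at u) v $ 3))) (at u)"
    by (simp add: rotation_diff_def flip: hpoint_eq)
  from partial_deriv_eq[OF this, of a]
  have "partial_deriv a (\<lambda>u. rotation_diff x0 y0 t (X u) (partial_deriv b X u)) u
     = hpoint (m ^ 2 * hpart xab + s * hpart xa * hpart xb) (xab $ 3)"
    by (simp add: xab_def xa_def partial_deriv_def)
  also have "partial_deriv a (\<lambda>u. rotation_diff x0 y0 t (X u) (partial_deriv b X u)) u
     = partial_deriv a (partial_deriv b (vertical_rotation x0 y0 t \<circ> X)) u"
    by (rule partial_deriv_cong_open[OF U u]) (simp add: rotation_comp_partial_deriv[OF d])
  finally have ab: "partial_deriv a (partial_deriv b (vertical_rotation x0 y0 t \<circ> X)) u
     = hpoint (m ^ 2 * hpart xab + s * hpart xa * hpart xb) (xab $ 3)" .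
  define j j' where "j = \<i> / complex_of_real (X u $ 2)"
    and "j' = \<i> / complex_of_real (vertical_rotation x0 y0 t (X u) $ 2)"
  have con: "s + j' * (m ^ 2) ^ 2 = m ^ 2 * j"
    using hyp_rotation_connection[OF y0, of "hpart (X u)" t x0] Xu
    by (simp add: s_def j_def j'_def m_def H2R_iff vertical_rotation_eq)
  have L: "cov_deriv (vertical_rotation x0 y0 t \<circ> X) a b u
    = hpoint (m ^ 2 * hpart xab + s * hpart xa * hpart xb) (xab $ 3)
       + hpoint (j' * (m ^ 2 * hpart xa) * (m ^ 2 * hpart xb)) 0"
    using vertical_rotation_in_H2R[OF y0 Xu, of x0 t]
    by (subst cov_deriv_eq)
      (simp_all add: ab rotation_comp_partial_deriv[OF d u] rotation_diff_def m_def xa_def xb_def j'_def)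
  have "s * hpart xa * hpart xb + j' * (m ^ 2 * hpart xa) * (m ^ 2 * hpart xb)
      = (s + j' * (m ^ 2) ^ 2) * hpart xa * hpart xb"
    by (simp add: algebra_simps power2_eq_square)
  then have E: "s * hpart xa * hpart xb + j' * (m ^ 2 * hpart xa) * (m ^ 2 * hpart xb)
      = m ^ 2 * (j * hpart xa * hpart xb)" by (simp only: con mult.assoc)
  have add: "hpoint w z + hpoint w' 0 = hpoint (w + w') z" for w w' z
    by (simp add: vec_eq_iff forall_3)
  have R: "cov_deriv X a b u = hpoint (hpart xab + j * hpart xa * hpart xb) (xab $ 3)"
    using add[of "hpart xab" "xab $ 3"] by (simp add: cov_deriv_eq[of X, OF Xu] xab_def xa_def xb_def j_def)
  show ?thesis
    unfolding L R add add.assoc E rotation_diff_def hpart_hpoint hpoint_nth m_def[symmetric] distrib_left ..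
qed

lemma mean_curvature_rotation_comp:
  assumes C: "Ck 2 U X" and u: "u \<in> U"
  shows "mean_curvature (vertical_rotation x0 y0 t \<circ> X) (rotation_diff x0 y0 t (X u) n) u
       = mean_curvature X n u"
proof -
  have d: "X differentiable_on U" using C by (simp add: numeral_2_eq_2)
  have Xu: "X u \<in> H2R" using H u by blast
  show ?thesis
    by (simp add: mean_curvature_def first_form_def second_form_def cov_deriv_rotation_comp[OF C u]
        rotation_comp_partial_deriv[OF d u] metric_rotation_diff[OF y0 Xu])
qed

end

section \<open>Maps of rank one in the plane\<close>

text \<open>Two functionals on the plane with a common nonzero kernel vector are proportional; stated as the
kernel of a nonzero functional being a line.\<close>

lemma linear_kernel_proportional:
  fixes f :: "real^2 \<Rightarrow> real"
  assumes "linear f" "f v = 0" "f x = 0" "v \<noteq> 0" "f y \<noteq> 0"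
  shows "\<exists>c. x = c *\<^sub>R v"
proof -
  define a b where "a = f (axis 1 1)" and "b = f (axis 2 1)"
  have f: "f z = z $ 1 * a + z $ 2 * b" for z
    using linear_vec_expand[OF assms(1), of z] by (simp add: sum_2 a_def b_def)
  have ab: "a \<noteq> 0 \<or> b \<noteq> 0" using f[of y] assms(5) by auto
  have 1: "v $ 1 * a + v $ 2 * b = 0" "x $ 1 * a + x $ 2 * b = 0" using f assms by auto
  have "a * (v $ 1 * x $ 2 - v $ 2 * x $ 1)
      = x $ 2 * (v $ 1 * a + v $ 2 * b) - v $ 2 * (x $ 1 * a + x $ 2 * b)"
    "b * (v $ 1 * x $ 2 - v $ 2 * x $ 1)
      = v $ 1 * (x $ 1 * a + x $ 2 * b) - x $ 1 * (v $ 1 * a + v $ 2 * b)"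
    by (simp_all add: algebra_simps)
  then have det: "v $ 1 * x $ 2 = v $ 2 * x $ 1" using ab unfolding 1 by auto
  show ?thesis
  proof (cases "v $ 1 = 0")
    case True
    then have "v $ 2 \<noteq> 0" using assms(4) by (simp add: vec_eq_iff forall_2)
    then show ?thesis using det True
      by (intro exI[of _ "x $ 2 / v $ 2"]) (simp add: vec_eq_iff forall_2)
  next
    case False
    then show ?thesis using det
      by (intro exI[of _ "x $ 1 / v $ 1"]) (simp add: vec_eq_iff forall_2 field_simps)
  qed
qed

text \<open>A case of the constant rank theorem.  If \<open>dg \<and> dh = 0\<close> and \<open>(g, b)\<close> are local coordinates, then \<open>h\<close> is
a function of \<open>g\<close> alone, so translating the coordinate \<open>b\<close> leaves both \<open>g\<close> and \<open>h\<close> unchanged.\<close>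

lemma rank_one_shift:
  fixes g h b :: "real^2 \<Rightarrow> real"
  assumes D: "open D" "u0 \<in> D" and C: "Ck 1 D g" "Ck 1 D b" and h: "h differentiable_on D"
    and rank: "\<And>u v w. \<lbrakk>u \<in> D; frechet_derivative g (at u) w \<noteq> 0; frechet_derivative g (at u) v = 0\<rbrakk>
                 \<Longrightarrow> frechet_derivative h (at u) v = 0"
    and inj0: "\<And>v. \<lbrakk>frechet_derivative g (at u0) v = 0; frechet_derivative b (at u0) v = 0\<rbrakk> \<Longrightarrow> v = 0"
  obtains U \<epsilon> where "open U" "u0 \<in> U" "U \<subseteq> D" "\<epsilon> > 0"
    "\<And>t. \<bar>t\<bar> < \<epsilon> \<Longrightarrow> \<exists>\<psi>. continuous_on U \<psi> \<and> inj_on \<psi> U \<and> \<psi> ` U \<subseteq> D \<and>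
        (\<forall>u\<in>U. g (\<psi> u) = g u \<and> h (\<psi> u) = h u \<and> b (\<psi> u) = b u + t)"
proof -
  define E :: "real^2 \<Rightarrow> real^2" where "E u = g u *\<^sub>R axis 1 1 + b u *\<^sub>R axis 2 1" for u
  have En: "E u $ 1 = g u" "E u $ 2 = b u" for u by (simp_all add: E_def axis_def)
  have gd: "g differentiable_on D" and bd: "b differentiable_on D" using C by auto
  have "Ck 1 D E"
    unfolding E_def
    by (intro Ck_add[OF D(1)] Ck_linear[OF D(1) bounded_linear_scaleR_left] C)
  then have contE: "continuous_on D (\<lambda>u. Blinfun (frechet_derivative E (at u)))"
    and Ed: "E differentiable_on D"
    using Ck_1_continuous_derivative[OF D(1)] by auto
  have dE: "frechet_derivative E (at u) v =
      frechet_derivative g (at u) v *\<^sub>R axis 1 1 + frechet_derivative b (at u) v *\<^sub>R axis 2 1"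
    if "u \<in> D" for u v
  proof -
    have "(E has_derivative (\<lambda>v. frechet_derivative g (at u) v *\<^sub>R axis 1 1
        + frechet_derivative b (at u) v *\<^sub>R axis 2 1)) (at u)"
      unfolding E_def
      by (intro has_derivative_add has_derivative_scaleR_left has_derivative_frechet[OF _ D(1) that] gd bd)
    from frechet_derivative_at[OF this, symmetric] show ?thesis by simp
  qed
  have dEn: "frechet_derivative E (at u) v $ 1 = frechet_derivative g (at u) v"
    "frechet_derivative E (at u) v $ 2 = frechet_derivative b (at u) v" if "u \<in> D" for u v
    by (simp_all add: dE[OF that] axis_def)
  have derE: "(E has_derivative frechet_derivative E (at u)) (at u)" if "u \<in> D" for u
    by (rule has_derivative_frechet[OF Ed D(1) that])
  have ap: "blinfun_apply (Blinfun (frechet_derivative E (at u))) = frechet_derivative E (at u)"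
    if "u \<in> D" for u
    using has_derivative_bounded_linear[OF derE[OF that]] by (rule bounded_linear_Blinfun_apply)
  have lin0: "linear (frechet_derivative E (at u0))"
    using has_derivative_linear[OF derE[OF D(2)]] .
  have "inj (frechet_derivative E (at u0))"
    unfolding linear_injective_0[OF lin0]
  proof (intro allI impI)
    fix v assume "frechet_derivative E (at u0) v = 0"
    then have "frechet_derivative E (at u0) v $ 1 = 0" "frechet_derivative E (at u0) v $ 2 = 0" by simp_all
    then show "v = 0" using inj0 dEn[OF D(2)] by simp
  qed
  then obtain k where k: "linear k" "k \<circ> frechet_derivative E (at u0) = id"
    using linear_injective_left_inverse[OF lin0] by blast
  have "Blinfun k o\<^sub>L Blinfun (frechet_derivative E (at u0)) = id_blinfun"
  proof (rule blinfun_eqI)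
    fix v
    have "blinfun_apply (Blinfun k) = k"
      using k(1) by (simp add: bounded_linear_Blinfun_apply linear_conv_bounded_linear)
    then show "blinfun_apply (Blinfun k o\<^sub>L Blinfun (frechet_derivative E (at u0))) v
        = blinfun_apply id_blinfun v"
      using k(2) by (simp add: ap[OF D(2)] fun_eq_iff)
  qed
  from inverse_function_theorem[OF D(1) _ contE D(2) this, of E]
  obtain U' V G G' where IF: "open U'" "U' \<subseteq> D" "u0 \<in> U'" "open V" "E u0 \<in> V" "homeomorphism U' V E G"
    "\<And>y. y \<in> V \<Longrightarrow> (G has_derivative (G' y)) (at y)"
    "\<And>y. y \<in> V \<Longrightarrow> G' y = inv (blinfun_apply (Blinfun (frechet_derivative E (at (G y)))))"
    "\<And>y. y \<in> V \<Longrightarrow> bij (blinfun_apply (Blinfun (frechet_derivative E (at (G y)))))"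
    using derE ap by (metis (no_types, lifting))
  have GE: "G (E u) = u" if "u \<in> U'" for u using IF(6) that by (simp add: homeomorphism_def)
  have EG: "E (G y) = y" "G y \<in> U'" if "y \<in> V" for y using IF(6) that by (auto simp: homeomorphism_def)
  have EU: "E u \<in> V" if "u \<in> U'" for u using IF(6) that by (auto simp: homeomorphism_def)
  obtain r where r: "r > 0" "ball (E u0) (2 * r) \<subseteq> V"
  proof -
    obtain r' where "r' > 0" "ball (E u0) r' \<subseteq> V" using IF(4,5) open_contains_ball by blast
    then show ?thesis using that[of "r'/2"] by simp
  qed
  define U where "U = {u \<in> U'. E u \<in> ball (E u0) r}"
  have contEU: "continuous_on U' E" using IF(6) by (simp add: homeomorphism_def)
  have oU: "open U" using continuous_open_preimage[OF contEU IF(1), of "ball (E u0) r"]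
    by (simp add: U_def vimage_def Int_def)
  have inV: "E u + s *\<^sub>R axis 2 1 \<in> V" if "u \<in> U" "\<bar>s\<bar> < r" for u s
  proof -
    have "dist (E u0) (E u + s *\<^sub>R axis 2 1) \<le> dist (E u0) (E u) + dist (E u) (E u + s *\<^sub>R axis 2 1)"
      by (rule dist_triangle)
    also have "\<dots> < 2 * r" using that by (simp add: U_def dist_norm)
    finally show ?thesis using r(2) by auto
  qed
  \<comment> \<open>Along a coordinate line of the second coordinate only \<open>b\<close> varies: by the rank hypothesis
    the differential of \<open>h\<close> vanishes wherever that of \<open>g\<close> does.\<close>
  have hconst: "h (G (E u + t *\<^sub>R axis 2 1)) = h u" if u: "u \<in> U" and t: "\<bar>t\<bar> < r" for u t
  proof -
    have "((\<lambda>s. h (G (E u + s *\<^sub>R axis 2 1))) has_derivative (\<lambda>_. 0)) (at s within ball 0 r)"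
      if s: "s \<in> ball 0 r" for s
    proof -
      define y where "y = E u + s *\<^sub>R axis 2 1"
      have y: "y \<in> V" using inV[OF u] s by (simp add: y_def)
      have Gy: "G y \<in> D" using EG(2)[OF y] IF(2) by blast
      have bij: "bij (frechet_derivative E (at (G y)))" using IF(9)[OF y] by (simp add: ap[OF Gy])
      have G': "G' y = inv (frechet_derivative E (at (G y)))" using IF(8)[OF y] by (simp add: ap[OF Gy])
      define v where "v = G' y (axis 2 1)"
      have v: "frechet_derivative E (at (G y)) v = axis 2 1"
        using bij by (simp add: v_def G' bij_is_surj surj_f_inv_f)
      then have gv: "frechet_derivative g (at (G y)) v = 0"
        using dEn(1)[OF Gy, of v] by (simp add: axis_def)
      obtain w where "frechet_derivative E (at (G y)) w = axis 1 1"
        using bij by (metis bij_pointE)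
      then have "frechet_derivative g (at (G y)) w \<noteq> 0"
        using dEn(1)[OF Gy, of w] by (simp add: axis_def)
      then have hv: "frechet_derivative h (at (G y)) v = 0" using rank Gy gv by blast
      have "((\<lambda>s. E u + s *\<^sub>R axis 2 1) has_derivative (\<lambda>\<sigma>. \<sigma> *\<^sub>R axis 2 1)) (at s)"
        by (auto intro!: derivative_eq_intros)
      from has_derivative_compose[OF this, of G "G' y"] IF(7)[OF y]
      have "((\<lambda>s. G (E u + s *\<^sub>R axis 2 1)) has_derivative (\<lambda>\<sigma>. G' y (\<sigma> *\<^sub>R axis 2 1))) (at s)"
        by (simp add: y_def)
      from has_derivative_compose[OF this, of h "frechet_derivative h (at (G y))"]
        has_derivative_frechet[OF h D(1) Gy]
      have A: "((\<lambda>s. h (G (E u + s *\<^sub>R axis 2 1))) has_derivative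
          (\<lambda>\<sigma>. frechet_derivative h (at (G y)) (G' y (\<sigma> *\<^sub>R axis 2 1)))) (at s)"
        by (simp add: y_def)
      have "frechet_derivative h (at (G y)) (G' y (\<sigma> *\<^sub>R axis 2 1)) = 0" for \<sigma>
        using linear_cmul[OF has_derivative_linear[OF IF(7)[OF y]]]
          linear_cmul[OF has_derivative_linear[OF has_derivative_frechet[OF h D(1) Gy]]] hv
        by (simp add: v_def)
      with A show ?thesis by (simp add: has_derivative_at_withinI)
    qed
    then have "\<exists>c. \<forall>s\<in>ball 0 r. h (G (E u + s *\<^sub>R axis 2 1)) = c"
      by (rule has_derivative_zero_constant[OF convex_ball])
    then obtain c where c: "\<And>s. s \<in> ball 0 r \<Longrightarrow> h (G (E u + s *\<^sub>R axis 2 1)) = c"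
      by blast
    have "u \<in> U'" using u by (simp add: U_def)
    then show ?thesis using c[of t] c[of 0] t r(1) GE by simp
  qed
  show thesis
  proof
    show "open U" by fact
    show "u0 \<in> U" using IF(3) r(1) by (simp add: U_def)
    show "U \<subseteq> D" using IF(2) by (auto simp: U_def)
    show "r > 0" by fact
    fix t :: real assume t: "\<bar>t\<bar> < r"
    define \<psi> where "\<psi> u = G (E u + t *\<^sub>R axis 2 1)" for u
    have E\<psi>: "E (\<psi> u) = E u + t *\<^sub>R axis 2 1" "\<psi> u \<in> D" if "u \<in> U" for u
      using EG[OF inV[OF that t]] IF(2) by (auto simp: \<psi>_def)
    have UU: "U \<subseteq> U'" by (auto simp: U_def)
    have "continuous_on V G" using IF(6) by (simp add: homeomorphism_def)
    moreover have "continuous_on U (\<lambda>u. E u + t *\<^sub>R axis 2 1)"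
      by (intro continuous_intros continuous_on_subset[OF contEU UU])
    moreover have "(\<lambda>u. E u + t *\<^sub>R axis 2 1) ` U \<subseteq> V" using inV t by blast
    ultimately have "continuous_on U \<psi>"
      unfolding \<psi>_def by (rule continuous_on_compose2)
    moreover have "inj_on \<psi> U"
    proof (rule inj_onI)
      fix u u' assume "u \<in> U" "u' \<in> U" "\<psi> u = \<psi> u'"
      then have "E u = E u'" using E\<psi>(1) by (metis add_right_cancel)
      then show "u = u'" using GE UU \<open>u \<in> U\<close> \<open>u' \<in> U\<close> by (metis subsetD)
    qed
    moreover have "g (\<psi> u) = g u \<and> h (\<psi> u) = h u \<and> b (\<psi> u) = b u + t" if "u \<in> U" for u
    proof -
      have "E (\<psi> u) $ 1 = E u $ 1" "E (\<psi> u) $ 2 = E u $ 2 + t"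
        unfolding E\<psi>(1)[OF that] by (simp_all add: axis_def)
      then show ?thesis using hconst[OF that t] by (simp add: En \<psi>_def)
    qed
    ultimately show "\<exists>\<psi>. continuous_on U \<psi> \<and> inj_on \<psi> U \<and> \<psi> ` U \<subseteq> D \<and>
        (\<forall>u\<in>U. g (\<psi> u) = g u \<and> h (\<psi> u) = h u \<and> b (\<psi> u) = b u + t)"
      using E\<psi>(2) by (intro exI[of _ \<psi>]) auto
  qed
qed

text \<open>Here \<open>l\<close> stands for a logarithmic polar coordinate about the axis and \<open>z\<close> for the height.  One of
\<open>Re l\<close> and \<open>z\<close> has a nonzero differential, since the immersion has rank two, and together with \<open>Im l\<close>
it gives local coordinates.  The translation in \<open>Im l\<close> is the lift of a rotation to the domain of
the chart.\<close>

lemma immersion_rank_one_shift: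
  fixes l :: "real^2 \<Rightarrow> complex" and z :: "real^2 \<Rightarrow> real"
  assumes D: "open D" "u0 \<in> D" and C: "Ck 1 D l" "Ck 1 D z"
    and imm: "\<And>u v. \<lbrakk>u \<in> D; frechet_derivative l (at u) v = 0; frechet_derivative z (at u) v = 0\<rbrakk> \<Longrightarrow> v = 0"
    and rank: "\<And>u. u \<in> D \<Longrightarrow> \<exists>v. v \<noteq> 0 \<and> Re (frechet_derivative l (at u) v) = 0 \<and> frechet_derivative z (at u) v = 0"
  obtains U \<epsilon> where "open U" "u0 \<in> U" "U \<subseteq> D" "\<epsilon> > 0"
    "\<And>t. \<bar>t\<bar> < \<epsilon> \<Longrightarrow> \<exists>\<psi>. continuous_on U \<psi> \<and> inj_on \<psi> U \<and> \<psi> ` U \<subseteq> D \<and>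
        (\<forall>u\<in>U. l (\<psi> u) = l u + \<i> * of_real t \<and> z (\<psi> u) = z u)"
proof -
  note goal = that
  have ld: "l differentiable_on D" and zd: "z differentiable_on D" using C by auto
  have CR: "Ck 1 D (\<lambda>u. Re (l u))" "Ck 1 D (\<lambda>u. Im (l u))"
    by (intro Ck_linear[OF D(1) bounded_linear_Re] Ck_linear[OF D(1) bounded_linear_Im] C)+
  have Rd: "(\<lambda>u. Re (l u)) differentiable_on D" using CR(1) by simp
  have dR: "frechet_derivative (\<lambda>u. Re (l u)) (at u) v = Re (frechet_derivative l (at u) v)"
    and dI: "frechet_derivative (\<lambda>u. Im (l u)) (at u) v = Im (frechet_derivative l (at u) v)"
    if "u \<in> D" for u v
    by (simp_all add: frechet_derivative_at[symmetric,
          OF bounded_linear.has_derivative[OF bounded_linear_Re has_derivative_frechet[OF ld D(1) that]]]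
        frechet_derivative_at[symmetric,
          OF bounded_linear.has_derivative[OF bounded_linear_Im has_derivative_frechet[OF ld D(1) that]]])
  have linz: "linear (frechet_derivative z (at u))"
    and linR: "linear (frechet_derivative (\<lambda>u. Re (l u)) (at u))" if "u \<in> D" for u
    using has_derivative_linear[OF has_derivative_frechet[OF zd D(1) that]]
      has_derivative_linear[OF has_derivative_frechet[OF Rd D(1) that]] .
  have rank1: "frechet_derivative z (at u) v = 0"
    if "u \<in> D" "frechet_derivative (\<lambda>u. Re (l u)) (at u) w \<noteq> 0" "frechet_derivative (\<lambda>u. Re (l u)) (at u) v = 0"
    for u v w
  proof -
    note hyps = that
    obtain k where k: "k \<noteq> 0" "Re (frechet_derivative l (at u) k) = 0" "frechet_derivative z (at u) k = 0"
      using rank[OF hyps(1)] by blast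
    then obtain c where "v = c *\<^sub>R k"
      using linear_kernel_proportional[OF linR[OF hyps(1)] _ hyps(3) k(1) hyps(2)] dR[OF hyps(1)] k(2) by auto
    then show ?thesis using k(3) linear_cmul[OF linz[OF that(1)]] by simp
  qed
  have rank2: "frechet_derivative (\<lambda>u. Re (l u)) (at u) v = 0"
    if "u \<in> D" "frechet_derivative z (at u) w \<noteq> 0" "frechet_derivative z (at u) v = 0" for u v w
  proof -
    note hyps = that
    obtain k where k: "k \<noteq> 0" "Re (frechet_derivative l (at u) k) = 0" "frechet_derivative z (at u) k = 0"
      using rank[OF hyps(1)] by blast
    then obtain c where "v = c *\<^sub>R k"
      using linear_kernel_proportional[OF linz[OF hyps(1)] k(3) hyps(3) k(1) hyps(2)] by auto
    then show ?thesis using k(2) linear_cmul[OF linR[OF that(1)]] dR[OF that(1)] by simp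
  qed
  have fin: thesis if a: "open U" "u0 \<in> U" "U \<subseteq> D" "\<epsilon> > 0"
    and b: "\<And>t. \<bar>t\<bar> < \<epsilon> \<Longrightarrow> \<exists>\<psi>. continuous_on U \<psi> \<and> inj_on \<psi> U \<and> \<psi> ` U \<subseteq> D \<and>
        (\<forall>u\<in>U. Re (l (\<psi> u)) = Re (l u) \<and> z (\<psi> u) = z u \<and> Im (l (\<psi> u)) = Im (l u) + t)" for U \<epsilon>
  proof (rule goal[OF a])
    fix t :: real assume "\<bar>t\<bar> < \<epsilon>"
    from b[OF this] show "\<exists>\<psi>. continuous_on U \<psi> \<and> inj_on \<psi> U \<and> \<psi> ` U \<subseteq> D \<and>
        (\<forall>u\<in>U. l (\<psi> u) = l u + \<i> * of_real t \<and> z (\<psi> u) = z u)"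
      by (simp add: complex_eq_iff conj_ac)
  qed
  show thesis
  proof (cases "\<exists>w. frechet_derivative (\<lambda>u. Re (l u)) (at u0) w \<noteq> 0")
    case True
    then obtain w where w: "frechet_derivative (\<lambda>u. Re (l u)) (at u0) w \<noteq> 0" ..
    have inj0: "v = 0" if "frechet_derivative (\<lambda>u. Re (l u)) (at u0) v = 0"
      "frechet_derivative (\<lambda>u. Im (l u)) (at u0) v = 0" for v
      using imm[OF D(2), of v] rank1[OF D(2) w that(1)] that dR[OF D(2)] dI[OF D(2)]
      by (simp add: complex_eq_iff)
    show thesis
      by (rule rank_one_shift[OF D CR zd rank1 inj0]) (assumption | rule fin)+
  next
    case False
    have inj0: "v = 0" if "frechet_derivative z (at u0) v = 0"
      "frechet_derivative (\<lambda>u. Im (l u)) (at u0) v = 0" for v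
      using imm[OF D(2), of v] False that dR[OF D(2)] dI[OF D(2)]
      by (simp add: complex_eq_iff)
    show thesis
    proof (rule rank_one_shift[OF D C(2) CR(2) Rd rank2 inj0])
      fix U \<epsilon> assume a: "open U" "u0 \<in> U" "U \<subseteq> D" "\<epsilon> > (0::real)"
        and b: "\<And>t. \<bar>t\<bar> < \<epsilon> \<Longrightarrow> \<exists>\<psi>. continuous_on U \<psi> \<and> inj_on \<psi> U \<and> \<psi> ` U \<subseteq> D \<and>
        (\<forall>u\<in>U. z (\<psi> u) = z u \<and> Re (l (\<psi> u)) = Re (l u) \<and> Im (l (\<psi> u)) = Im (l u) + t)"
      have c: "\<exists>\<psi>. continuous_on U \<psi> \<and> inj_on \<psi> U \<and> \<psi> ` U \<subseteq> D \<and>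
        (\<forall>u\<in>U. Re (l (\<psi> u)) = Re (l u) \<and> z (\<psi> u) = z u \<and> Im (l (\<psi> u)) = Im (l u) + t)"
        if "\<bar>t\<bar> < \<epsilon>" for t using b[OF that] by metis
      show thesis by (rule fin[OF a c])
    qed
  qed
qed

section \<open>Charts of immersed surfaces\<close>

lemma surface_chart_subset_topspace:
  assumes "surface_chart M f D \<phi>" "u \<in> D"
  shows "\<phi> u \<in> topspace M"
  using assms openin_subset unfolding surface_chart_def by blast

lemma surface_chart_Ck:
  assumes "surface_chart M f D \<phi>"
  shows "Ck k D (f \<circ> \<phi>)"
  using assms by (simp add: surface_chart_def smooth_immersion_on_def Ck_on_iff_Ck)

lemma surface_chart_differentiable:
  assumes "surface_chart M f D \<phi>"
  shows "(f \<circ> \<phi>) differentiable_on D"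
  using surface_chart_Ck[OF assms, of 1] by simp

text \<open>Smoothness is asked of the composed immersion, so a reparametrization obtained from an inverse
function enters through its continuity alone.  Openness of its image is invariance of domain.\<close>

lemma surface_chart_reparam:
  assumes ch: "surface_chart M f D \<phi>" and U: "open U"
    and \<psi>: "continuous_on U \<psi>" "inj_on \<psi> U" "\<psi> ` U \<subseteq> D"
    and sm: "smooth_immersion_on U (f \<circ> (\<phi> \<circ> \<psi>))"
  shows "surface_chart M f U (\<phi> \<circ> \<psi>)"
proof -
  define V where "V = \<psi> ` U"
  have V: "open V" "V \<subseteq> D" using invariance_of_domain[OF \<psi>(1) U \<psi>(2)] \<psi>(3) by (auto simp: V_def)
  obtain \<theta> where "homeomorphism U V \<psi> \<theta>"
    using invariance_of_domain_homeomorphism[OF U \<psi>(1) _ \<psi>(2)] by (auto simp: V_def)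
  then have "homeomorphic_maps (top_of_set U) (top_of_set V) \<psi> \<theta>"
    by (auto simp: homeomorphic_maps_def homeomorphism_def)
  then have h1: "homeomorphic_map (top_of_set U) (top_of_set V) \<psi>"
    using homeomorphic_map_maps by blast
  have D: "open D" "openin M (\<phi> ` D)"
    and hD: "homeomorphic_map (top_of_set D) (subtopology M (\<phi> ` D)) \<phi>"
    using ch by (auto simp: surface_chart_def)
  have top: "topspace M \<inter> \<phi> ` D = \<phi> ` D" using openin_subset[OF D(2)] by blast
  have "openin (subtopology M (\<phi> ` D)) (\<phi> ` V)"
    using homeomorphic_imp_open_map[OF hD] open_subset[OF V(2,1)] by (auto simp: open_map_def)
  then have oV: "openin M (\<phi> ` V)" using openin_open_subtopology[OF D(2)] by blast
  have "homeomorphic_map (subtopology (top_of_set D) V) (subtopology (subtopology M (\<phi> ` D)) (\<phi> ` V)) \<phi>"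
    using V(2) by (intro homeomorphic_map_subtopologies[OF hD]) (auto simp: top Int_absorb1)
  then have h2: "homeomorphic_map (top_of_set V) (subtopology M (\<phi> ` V)) \<phi>"
    using V(2) image_mono[OF V(2), of \<phi>] by (simp add: subtopology_subtopology Int_absorb1)
  show ?thesis
    unfolding surface_chart_def image_comp[symmetric] V_def[symmetric]
    using U oV homeomorphic_map_compose[OF h1 h2] sm by blast
qed

text \<open>Second countability gives countably many charts, and each has an image of dimension two in a
three-dimensional space.\<close>

lemma negligible_immersed_surface:
  assumes "immersed_surface M f"
  shows "negligible (f ` topspace M)"
proof -
  define \<U> where "\<U> = {\<phi> ` D |D \<phi>. surface_chart M f D \<phi>}"
  have op: "\<And>U. U \<in> \<U> \<Longrightarrow> openin M U" by (auto simp: \<U>_def surface_chart_def)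
  have cov: "topspace M \<subseteq> \<Union>\<U>"
    using assms unfolding immersed_surface_def \<U>_def by blast
  have "Lindelof_space M"
    using assms second_countable_imp_Lindelof_space by (auto simp: immersed_surface_def)
  then obtain \<V> where V: "countable \<V>" "\<V> \<subseteq> \<U>" "topspace M \<subseteq> \<Union>\<V>"
    using op cov unfolding Lindelof_space_alt by meson
  have "negligible (f ` U)" if U: "U \<in> \<V>" for U
  proof -
    obtain D \<phi> where ch: "surface_chart M f D \<phi>" "U = \<phi> ` D" using U V(2) by (auto simp: \<U>_def)
    have "negligible ((f \<circ> \<phi>) ` D)"
      by (rule negligible_differentiable_image_lowdim[OF _ surface_chart_differentiable[OF ch(1)]]) simp
    then show ?thesis by (simp add: ch(2) image_comp)
  qed
  then have "negligible (\<Union>((`) f ` \<V>))"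
    using V(1) by (intro negligible_countable_Union) auto
  moreover have "f ` topspace M \<subseteq> \<Union>((`) f ` \<V>)" using V(3) by blast
  ultimately show ?thesis using negligible_subset by blast
qed

section \<open>Logarithmic polar coordinates about the axis\<close>

text \<open>The logarithm of the disk coordinate, normalized by a value \<open>\<delta>\<close> at a base point so that the
principal branch is smooth nearby.  Its real part depends only on the distance to the axis, and a
rotation by \<open>t\<close> adds \<open>\<i> t\<close>.\<close>

definition log_polar :: "real \<Rightarrow> real \<Rightarrow> complex \<Rightarrow> real^3 \<Rightarrow> complex" where
  "log_polar x0 y0 \<delta> p = Ln (disk x0 y0 (hpart p) / \<delta>)"

text \<open>The part of space over the half of the disk that faces the direction of \<open>\<delta>\<close>; there the quotient by
\<open>\<delta>\<close> avoids the branch cut.\<close>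

definition half_disk :: "real \<Rightarrow> real \<Rightarrow> complex \<Rightarrow> (real^3) set" where
  "half_disk x0 y0 \<delta> = {p \<in> H2R. Re (disk x0 y0 (hpart p) / \<delta>) > 0}"

lemma open_H2R: "open H2R"
  unfolding H2R_def by (intro open_Collect_less continuous_intros)

context
  fixes x0 y0 :: real and \<delta> :: complex
  assumes y0: "y0 > 0" and \<delta>: "\<delta> \<noteq> 0"
begin

lemma continuous_on_disk: "continuous_on H2R (\<lambda>p. disk x0 y0 (hpart p))"
proof -
  have "continuous_on {w. Im w > 0} (disk x0 y0)"
    using disk_deriv[OF y0] by (intro DERIV_continuous_on) (auto intro: has_field_derivative_at_within)
  then show ?thesis
    by (rule continuous_on_compose2)
      (auto simp: H2R_iff intro: linear_continuous_on bounded_linear_hpart)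
qed

lemma open_half_disk: "open (half_disk x0 y0 \<delta>)"
proof -
  have "continuous_on H2R (\<lambda>p. Re (disk x0 y0 (hpart p) / \<delta>))"
    using \<delta> by (intro continuous_intros continuous_on_disk) auto
  from continuous_open_preimage[OF this open_H2R, of "{0<..}"] show ?thesis
    by (simp add: half_disk_def vimage_def Int_def)
qed

lemma disk_nonzero_half_disk:
  assumes "p \<in> half_disk x0 y0 \<delta>" shows "disk x0 y0 (hpart p) \<noteq> 0"
  using assms by (auto simp: half_disk_def)

lemma exp_log_polar:
  assumes "p \<in> half_disk x0 y0 \<delta>"
  shows "disk x0 y0 (hpart p) = \<delta> * exp (log_polar x0 y0 \<delta> p)"
  using disk_nonzero_half_disk[OF assms] \<delta> by (simp add: log_polar_def)

lemma rotation_from_log_polar: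
  assumes p: "p \<in> half_disk x0 y0 \<delta>" and q: "q \<in> half_disk x0 y0 \<delta>"
    and l: "log_polar x0 y0 \<delta> q = log_polar x0 y0 \<delta> p + \<i> * of_real t" and z: "q $ 3 = p $ 3"
  shows "q = vertical_rotation x0 y0 t p"
proof -
  have "disk x0 y0 (hpart q) = cis t * disk x0 y0 (hpart p)"
    by (simp add: exp_log_polar[OF p] exp_log_polar[OF q] l exp_add cis_conv_exp)
  then have "hpart q = hyp_rotation x0 y0 t (hpart p)"
    using p q by (intro hyp_rotation_eqI[OF y0]) (auto simp: half_disk_def H2R_iff simp del: hpart_sel)
  then show ?thesis
    using hpoint_hpart[of q] by (simp add: vertical_rotation_eq z)
qed

text \<open>The complex derivative of \<^const>\<open>log_polar\<close>; the factor \<open>\<delta>\<close> cancels in it.\<close>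

definition log_polar_diff :: "real^3 \<Rightarrow> complex" where
  "log_polar_diff p = 2 * \<i> * of_real y0 / (hpart p - Complex x0 (- y0))\<^sup>2 / disk x0 y0 (hpart p)"

lemma log_polar_diff_nonzero:
  assumes "p \<in> half_disk x0 y0 \<delta>" shows "log_polar_diff p \<noteq> 0"
  using disk_nonzero_half_disk[OF assms] y0 disk_den_nonzero[OF y0, of "hpart p" x0] assms
  by (simp add: log_polar_diff_def half_disk_def H2R_iff)

lemma continuous_on_log_polar_diff: "continuous_on (half_disk x0 y0 \<delta>) log_polar_diff"
proof -
  have sub: "half_disk x0 y0 \<delta> \<subseteq> H2R" by (auto simp: half_disk_def)
  have hp: "continuous_on (half_disk x0 y0 \<delta>) hpart"
    by (rule linear_continuous_on[OF bounded_linear_hpart])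
  have "hpart p - Complex x0 (- y0) \<noteq> 0" if "p \<in> half_disk x0 y0 \<delta>" for p
    using disk_den_nonzero[OF y0, of "hpart p" x0] that by (simp add: half_disk_def H2R_iff)
  then show ?thesis
    unfolding log_polar_diff_def[abs_def]
    using disk_nonzero_half_disk
    by (intro continuous_intros hp continuous_on_subset[OF continuous_on_disk sub]) auto
qed

lemma log_polar_has_derivative:
  assumes "p \<in> half_disk x0 y0 \<delta>"
  shows "(log_polar x0 y0 \<delta> has_derivative (\<lambda>v. log_polar_diff p * hpart v)) (at p)"
proof -
  have im: "Im (hpart p) > 0" and re: "Re (disk x0 y0 (hpart p) / \<delta>) > 0"
    using assms by (auto simp: half_disk_def H2R_iff)
  have "disk x0 y0 (hpart p) / \<delta> \<notin> \<real>\<^sub>\<le>\<^sub>0" using re by (auto simp: complex_nonpos_Reals_iff)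
  from DERIV_chain2[OF has_field_derivative_Ln[OF this] DERIV_cdivide[OF disk_deriv[OF y0 im, of x0]]]
  have "((\<lambda>w. Ln (disk x0 y0 w / \<delta>)) has_field_derivative log_polar_diff p) (at (hpart p))"
    using \<delta> disk_nonzero_half_disk[OF assms] by (simp add: log_polar_diff_def field_simps)
  from has_derivative_compose[OF bounded_linear_imp_has_derivative[OF bounded_linear_hpart]
      this[unfolded has_field_derivative_def]]
  show ?thesis by (simp add: log_polar_def[abs_def])
qed

lemma frechet_log_polar_comp:
  assumes "X differentiable_on D" "open D" "u \<in> D" "X u \<in> half_disk x0 y0 \<delta>"
  shows "((\<lambda>u. log_polar x0 y0 \<delta> (X u)) has_derivative
      (\<lambda>v. log_polar_diff (X u) * hpart (frechet_derivative X (at u) v))) (at u)"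
  using has_derivative_compose[OF has_derivative_frechet[OF assms(1-3)] log_polar_has_derivative[OF assms(4)]] .

lemma Ck_1_log_polar_comp:
  assumes C: "Ck 1 D X" and D: "open D" and X: "X ` D \<subseteq> half_disk x0 y0 \<delta>"
  shows "Ck 1 D (\<lambda>u. log_polar x0 y0 \<delta> (X u))"
proof -
  have d: "X differentiable_on D" and c: "\<And>i. continuous_on D (partial_deriv i X)" using C by auto
  have der: "((\<lambda>u. log_polar x0 y0 \<delta> (X u)) has_derivative
      (\<lambda>v. log_polar_diff (X u) * hpart (frechet_derivative X (at u) v))) (at u)" if "u \<in> D" for u
    using frechet_log_polar_comp[OF d D that] X that by blast
  have "(\<lambda>u. log_polar x0 y0 \<delta> (X u)) differentiable_on D"
    using der D differentiable_on_eq_differentiable_at differentiable_def by blast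
  moreover have "continuous_on D (partial_deriv i (\<lambda>u. log_polar x0 y0 \<delta> (X u)))" for i
  proof -
    have "continuous_on D (\<lambda>u. log_polar_diff (X u) * hpart (partial_deriv i X u))"
      using differentiable_imp_continuous_on[OF d] X
      by (intro continuous_on_mult continuous_on_compose2[OF continuous_on_log_polar_diff]
          bounded_linear.continuous_on[OF bounded_linear_hpart] c)
    then show ?thesis
      using partial_deriv_eq[OF der] by (simp add: partial_deriv_def cong: continuous_on_cong_simp)
  qed
  ultimately show ?thesis by simp
qed

end

section \<open>Tangency of the orbits\<close>

definition pair2 :: "real \<Rightarrow> real \<Rightarrow> real^2" where
  "pair2 a b = a *\<^sub>R axis 1 1 + b *\<^sub>R axis 2 1"

lemma pair2_nth [simp]: "pair2 a b $ 1 = a" "pair2 a b $ 2 = b"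
  by (simp_all add: pair2_def axis_def)

lemma pair2_eq_iff: "pair2 a b = pair2 c d \<longleftrightarrow> a = c \<and> b = d"
  by (metis pair2_nth)

lemma continuous_on_pair2 [continuous_intros]:
  "continuous_on S a \<Longrightarrow> continuous_on S b \<Longrightarrow> continuous_on S (\<lambda>x. pair2 (a x) (b x))"
  unfolding pair2_def by (intro continuous_intros)

lemma injective_derivative_open_image:
  fixes a b :: "real^2 \<Rightarrow> real"
  assumes S: "open S" "u \<in> S" and c: "continuous_on S a" "continuous_on S b"
    and d: "(a has_derivative a') (at u)" "(b has_derivative b') (at u)"
    and inj: "\<And>v. a' v = 0 \<Longrightarrow> b' v = 0 \<Longrightarrow> v = 0"
  obtains W where "open W" "pair2 (a u) (b u) \<in> W" "W \<subseteq> (\<lambda>x. pair2 (a x) (b x)) ` S"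
proof -
  have der: "((\<lambda>x. pair2 (a x) (b x)) has_derivative (\<lambda>v. pair2 (a' v) (b' v))) (at u)"
    unfolding pair2_def by (intro has_derivative_add has_derivative_scaleR_left d)
  have lin: "linear (\<lambda>v. pair2 (a' v) (b' v))" using has_derivative_linear[OF der] .
  have "inj (\<lambda>v. pair2 (a' v) (b' v))"
    unfolding linear_injective_0[OF lin]
  proof (intro allI impI)
    fix v assume "pair2 (a' v) (b' v) = 0"
    then have "pair2 (a' v) (b' v) $ 1 = 0" "pair2 (a' v) (b' v) $ 2 = 0" by simp_all
    then show "v = 0" using inj by simp
  qed
  then obtain k where k: "linear k" "\<And>x. pair2 (a' (k x)) (b' (k x)) = x"
    using linear_injective_isomorphism[OF lin] by blast
  have "pair2 (a u) (b u) \<in> interior ((\<lambda>x. pair2 (a x) (b x)) ` S)"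
    using k S
    by (intro sussmann_open_mapping[OF S(1) _ S(2) der, of k S] continuous_intros c)
      (auto simp: linear_conv_bounded_linear fun_eq_iff interior_open)
  then show thesis using that[OF open_interior] interior_subset by blast
qed

context
  fixes M :: "'m topology" and f :: "'m \<Rightarrow> real^3" and x0 y0 :: real
  assumes surf: "immersed_surface M f" and y0: "y0 > 0"
    and rot: "\<And>t. vertical_rotation x0 y0 t ` f ` topspace M = f ` topspace M"
begin

lemma chart_image_H2R:
  assumes "surface_chart M f D \<phi>"
  shows "(f \<circ> \<phi>) ` D \<subseteq> H2R"
  using surf surface_chart_subset_topspace[OF assms] by (auto simp: immersed_surface_def)

text \<open>If polar radius and height had independent differentials at a point of the surface, their values
would fill an open set of the plane.  The orbits over this set would fill an open set in space, and
all of them lie in the image, which is negligible.  Hence some tangent vector changes neither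
coordinate.\<close>

lemma orbit_tangent:
  assumes ch: "surface_chart M f D \<phi>" and \<delta>: "\<delta> \<noteq> 0" and D': "open D'" "D' \<subseteq> D"
    and half: "(f \<circ> \<phi>) ` D' \<subseteq> half_disk x0 y0 \<delta>" and u: "u \<in> D'"
  shows "\<exists>v. v \<noteq> 0 \<and> Re (frechet_derivative (\<lambda>u. log_polar x0 y0 \<delta> ((f \<circ> \<phi>) u)) (at u) v) = 0
           \<and> frechet_derivative (\<lambda>u. (f \<circ> \<phi>) u $ 3) (at u) v = 0"
proof (rule ccontr)
  define X where "X = f \<circ> \<phi>"
  define l z where "l u = log_polar x0 y0 \<delta> (X u)" and "z u = X u $ 3" for u
  assume neg: "\<not> ?thesis"
  have CX: "Ck 1 D' X" using Ck_subset[OF surface_chart_Ck[OF ch] D'(2)] by (simp add: X_def)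
  have C: "Ck 1 D' l" "Ck 1 D' z"
    using Ck_1_log_polar_comp[OF y0 \<delta> CX D'(1)] half Ck_linear[OF D'(1) bounded_linear_vec_nth CX]
    by (auto simp: l_def[abs_def] z_def[abs_def] X_def)
  then have diff: "l differentiable_on D'" "z differentiable_on D'" by auto
  have dl: "((\<lambda>u. Re (l u)) has_derivative (\<lambda>v. Re (frechet_derivative l (at u) v))) (at u)"
    using bounded_linear.has_derivative[OF bounded_linear_Re has_derivative_frechet[OF diff(1) D'(1) u]] .
  have dz: "(z has_derivative frechet_derivative z (at u)) (at u)"
    using has_derivative_frechet[OF diff(2) D'(1) u] .
  have inj: "v = 0" if "Re (frechet_derivative l (at u) v) = 0" "frechet_derivative z (at u) v = 0" for v
    using neg that by (auto simp: l_def[abs_def] z_def[abs_def] X_def)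
  have cont: "continuous_on D' (\<lambda>u. Re (l u))" "continuous_on D' z"
    using diff by (auto intro!: continuous_intros dest: differentiable_imp_continuous_on)
  obtain W where W: "open W" "pair2 (Re (l u)) (z u) \<in> W" "W \<subseteq> (\<lambda>x. pair2 (Re (l x)) (z x)) ` D'"
    using injective_derivative_open_image[OF D'(1) u cont dl dz inj] by blast
  \<comment> \<open>The points with polar radius and height in \<open>W\<close> lie on orbits that meet the surface.\<close>
  define S where "S = {p \<in> half_disk x0 y0 \<delta>. pair2 (Re (log_polar x0 y0 \<delta> p)) (p $ 3) \<in> W}"
  have "continuous_on (half_disk x0 y0 \<delta>) (log_polar x0 y0 \<delta>)"
    using log_polar_has_derivative[OF y0 \<delta>]
    by (intro has_derivative_continuous_on) (auto intro: has_derivative_at_withinI)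
  then have "continuous_on (half_disk x0 y0 \<delta>) (\<lambda>p. pair2 (Re (log_polar x0 y0 \<delta> p)) (p $ 3))"
    by (intro continuous_intros)
  from continuous_open_preimage[OF this open_half_disk[OF y0 \<delta>] W(1)]
  have "open S" by (simp add: S_def vimage_def Int_def)
  moreover have "X u \<in> S" using half u W(2) by (auto simp: S_def l_def z_def X_def)
  moreover have "S \<subseteq> f ` topspace M"
  proof
    fix p assume p: "p \<in> S"
    then obtain x where x: "x \<in> D'" "Re (log_polar x0 y0 \<delta> p) = Re (l x)" "p $ 3 = z x"
      using W(3) by (auto simp: S_def pair2_eq_iff)
    have Xx: "X x \<in> half_disk x0 y0 \<delta>" using half x(1) by (auto simp: X_def)
    define t where "t = Im (log_polar x0 y0 \<delta> p) - Im (l x)"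
    have "log_polar x0 y0 \<delta> p = log_polar x0 y0 \<delta> (X x) + \<i> * of_real t"
      using x(2) by (simp add: complex_eq_iff t_def l_def)
    then have "p = vertical_rotation x0 y0 t (X x)"
      using p x(3) by (intro rotation_from_log_polar[OF y0 \<delta> Xx]) (auto simp: S_def z_def)
    moreover have "X x \<in> f ` topspace M"
      using surface_chart_subset_topspace[OF ch] x(1) D'(2) by (auto simp: X_def)
    ultimately show "p \<in> f ` topspace M" using rot[of t] by blast
  qed
  ultimately show False
    using open_not_negligible negligible_subset[OF negligible_immersed_surface[OF surf]] by blast
qed

text \<open>The invariance of the image under rotations becomes an invariance of the surface itself: near a
point off the axis the rotations by small angles lift to the domain of any chart.\<close>

lemma local_rotation_invariance:
  assumes ch: "surface_chart M f D \<phi>" and u0: "u0 \<in> D" and off: "hpart (f (\<phi> u0)) \<noteq> Complex x0 y0"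
  obtains U \<epsilon> where "open U" "u0 \<in> U" "U \<subseteq> D" "\<epsilon> > 0"
    "\<forall>t. \<bar>t\<bar> < \<epsilon> \<longrightarrow> (\<exists>\<psi>. continuous_on U \<psi> \<and> inj_on \<psi> U \<and> \<psi> ` U \<subseteq> D \<and>
        (\<forall>u\<in>U. f (\<phi> (\<psi> u)) = vertical_rotation x0 y0 t (f (\<phi> u))))"
proof -
  note goal = that
  define X where "X = f \<circ> \<phi>"
  define \<delta> where "\<delta> = disk x0 y0 (hpart (X u0))"
  have D: "open D" using ch by (simp add: surface_chart_def)
  have XH: "X ` D \<subseteq> H2R" using chart_image_H2R[OF ch] by (simp add: X_def)
  have Xu0: "X u0 \<in> H2R" using XH u0 by blast
  then have \<delta>: "\<delta> \<noteq> 0"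
    using disk_eq_0_iff[OF y0, of "hpart (X u0)" x0] off by (simp add: \<delta>_def H2R_iff X_def)
  define D' where "D' = {u \<in> D. X u \<in> half_disk x0 y0 \<delta>}"
  have Xd: "X differentiable_on D" using surface_chart_differentiable[OF ch] by (simp add: X_def)
  have D'o: "open D'"
    using continuous_open_preimage[OF differentiable_imp_continuous_on[OF Xd] D open_half_disk[OF y0 \<delta>]]
    by (simp add: D'_def vimage_def Int_def)
  have u0': "u0 \<in> D'" using u0 Xu0 \<delta> by (simp add: D'_def half_disk_def \<delta>_def)
  have sub: "D' \<subseteq> D" and half: "X ` D' \<subseteq> half_disk x0 y0 \<delta>" by (auto simp: D'_def)
  have CX: "Ck 1 D' X" using Ck_subset[OF surface_chart_Ck[OF ch] sub] by (simp add: X_def)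
  then have Xd': "X differentiable_on D'" by simp
  define l z where "l u = log_polar x0 y0 \<delta> (X u)" and "z u = X u $ 3" for u
  have C: "Ck 1 D' l" "Ck 1 D' z"
    using Ck_1_log_polar_comp[OF y0 \<delta> CX D'o half] Ck_linear[OF D'o bounded_linear_vec_nth CX]
    by (auto simp: l_def[abs_def] z_def[abs_def])
  have imm: "v = 0" if u: "u \<in> D'" and l0: "frechet_derivative l (at u) v = 0"
    and z0: "frechet_derivative z (at u) v = 0" for u v
  proof -
    have Xu: "X u \<in> half_disk x0 y0 \<delta>" using half u by blast
    have "frechet_derivative l (at u) v = log_polar_diff x0 y0 (X u) * hpart (frechet_derivative X (at u) v)"
      using frechet_derivative_at[OF frechet_log_polar_comp[OF y0 \<delta> Xd' D'o u Xu], symmetric]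
      by (simp add: l_def[abs_def])
    then have h: "hpart (frechet_derivative X (at u) v) = 0"
      using l0 log_polar_diff_nonzero[OF y0 \<delta> Xu] by simp
    have "frechet_derivative z (at u) v = frechet_derivative X (at u) v $ 3"
      using frechet_derivative_at[OF bounded_linear.has_derivative[OF bounded_linear_vec_nth[of 3]
            has_derivative_frechet[OF Xd' D'o u]], symmetric]
      by (simp add: z_def[abs_def])
    then have "frechet_derivative X (at u) v = 0"
      using h z0 by (simp add: vec_eq_iff forall_3 complex_eq_iff)
    moreover have "inj (frechet_derivative X (at u))"
      using ch u sub by (auto simp: surface_chart_def smooth_immersion_on_def X_def)
    ultimately show "v = 0"
      using linear_injective_0[OF has_derivative_linear[OF has_derivative_frechet[OF Xd' D'o u]]] by blast
  qed
  have rank: "\<exists>v. v \<noteq> 0 \<and> Re (frechet_derivative l (at u) v) = 0 \<and> frechet_derivative z (at u) v = 0"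
    if "u \<in> D'" for u
    using orbit_tangent[OF ch \<delta> D'o sub _ that] half by (simp add: l_def[abs_def] z_def[abs_def] X_def)
  show thesis
  proof (rule immersion_rank_one_shift[OF D'o u0' C])
    show "v = 0" if "u \<in> D'" "frechet_derivative l (at u) v = 0" "frechet_derivative z (at u) v = 0" for u v
      using imm[OF that] .
    show "\<exists>v. v \<noteq> 0 \<and> Re (frechet_derivative l (at u) v) = 0 \<and> frechet_derivative z (at u) v = 0"
      if "u \<in> D'" for u using rank[OF that] .
    fix U \<epsilon> assume U: "open U" "u0 \<in> U" "U \<subseteq> D'" "\<epsilon> > (0::real)"
      and \<psi>: "\<And>t. \<bar>t\<bar> < \<epsilon> \<Longrightarrow> \<exists>\<psi>. continuous_on U \<psi> \<and> inj_on \<psi> U \<and> \<psi> ` U \<subseteq> D' \<and>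
        (\<forall>u\<in>U. l (\<psi> u) = l u + \<i> * of_real t \<and> z (\<psi> u) = z u)"
    show thesis
    proof (rule goal[OF U(1,2) _ U(4)], goal_cases)
      case 1
      show ?case using U(3) sub by blast
    next
      case 2
      show ?case
      proof (intro allI impI)
        fix t assume "\<bar>t\<bar> < \<epsilon>"
        then obtain \<psi> where p: "continuous_on U \<psi>" "inj_on \<psi> U" "\<psi> ` U \<subseteq> D'"
          and e: "\<And>u. u \<in> U \<Longrightarrow> l (\<psi> u) = l u + \<i> * of_real t \<and> z (\<psi> u) = z u"
          using \<psi> by blast
        have "X (\<psi> u) = vertical_rotation x0 y0 t (X u)" if u: "u \<in> U" for u
        proof (rule rotation_from_log_polar[OF y0 \<delta>])
          have "u \<in> D'" "\<psi> u \<in> D'" using u U(3) p(3) by blast+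
          then show "X u \<in> half_disk x0 y0 \<delta>" "X (\<psi> u) \<in> half_disk x0 y0 \<delta>" using half by blast+
        qed (use e[OF u] in \<open>auto simp: l_def z_def\<close>)
        then show "\<exists>\<psi>. continuous_on U \<psi> \<and> inj_on \<psi> U \<and> \<psi> ` U \<subseteq> D \<and>
            (\<forall>u\<in>U. f (\<phi> (\<psi> u)) = vertical_rotation x0 y0 t (f (\<phi> u)))"
          using p sub by (intro exI[of _ \<psi>]) (auto simp: X_def)
      qed
    qed
  qed
qed

end

section \<open>Unit normals\<close>

lemma metric_commute: "metric p v w = metric p w v"
  by (simp add: metric_def mult.commute)

lemma linear_metric: "linear (metric p v)"
  by (rule linearI) (simp_all add: metric_def add_divide_distrib algebra_simps)

lemma metric_uminus_left: "metric p (- v) w = - metric p v w"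
  by (simp add: metric_def diff_divide_distrib add_divide_distrib)

lemma metric_self_eq_0:
  assumes "p \<in> H2R" "metric p v v = 0" shows "v = 0"
proof -
  have y: "p $ 2 > 0" using assms by (simp add: H2R_def)
  have "(v $ 1 * v $ 1 + v $ 2 * v $ 2) / (p $ 2)\<^sup>2 \<ge> 0" by simp
  moreover have "v $ 3 * v $ 3 \<ge> 0" by simp
  ultimately have "(v $ 1 * v $ 1 + v $ 2 * v $ 2) / (p $ 2)\<^sup>2 = 0" "v $ 3 * v $ 3 = 0"
    using assms(2) unfolding metric_def by linarith+
  then have "v $ 1 = 0" "v $ 2 = 0" "v $ 3 = 0" using y by (auto simp: sum_squares_eq_zero_iff)
  then show ?thesis by (simp add: vec_eq_iff forall_3)
qed

text \<open>The difference of \<open>m\<close> and its projection to \<open>n\<close> is orthogonal to a basis of the tangent space of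
the ambient space.\<close>

lemma unit_normal_unique:
  fixes L :: "real^2 \<Rightarrow> real^3"
  assumes p: "p \<in> H2R" and L: "linear L" "inj L"
    and n: "metric p n n = 1" "\<And>w. metric p n (L w) = 0"
    and m: "metric p m m = 1" "\<And>w. metric p m (L w) = 0"
  shows "m = n \<or> m = - n"
proof -
  define c where "c = metric p m n"
  define v where "v = m - c *\<^sub>R n"
  have lin: "metric p a (b + d) = metric p a b + metric p a d" "metric p a (r *\<^sub>R b) = r * metric p a b"
    for a b d r using linear_add[OF linear_metric] linear_cmul[OF linear_metric] by auto
  have vm: "metric p v a = metric p m a - c * metric p n a" for a
    by (simp add: v_def metric_def algebra_simps add_divide_distrib diff_divide_distrib)
  define S :: "real^3 \<Rightarrow> real^3" where "S x = L (pair2 (x $ 1) (x $ 2)) + x $ 3 *\<^sub>R n" for x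
  have pr: "pair2 (a + a') (b + b') = pair2 a b + pair2 a' b'" "pair2 (r * a) (r * b) = r *\<^sub>R pair2 a b"
    for a b a' b' r by (simp_all add: vec_eq_iff forall_2)
  have linS: "linear S"
    by (rule linearI) (simp_all add: S_def pr linear_add[OF L(1)] linear_cmul[OF L(1)] algebra_simps)
  have "inj S"
    unfolding linear_injective_0[OF linS]
  proof (intro allI impI)
    fix x assume x: "S x = 0"
    then have "metric p n (S x) = 0" by (simp add: linear_0[OF linear_metric])
    then have 3: "x $ 3 = 0" by (simp add: S_def lin n)
    then have "L (pair2 (x $ 1) (x $ 2)) = 0" using x by (simp add: S_def)
    then have "pair2 (x $ 1) (x $ 2) = 0" using linear_injective_0[OF L(1)] L(2) by blast
    then have "x $ 1 = 0" "x $ 2 = 0" by (metis pair2_nth zero_index)+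
    then show "x = 0" using 3 by (simp add: vec_eq_iff forall_3)
  qed
  then have "surj S" using linear_injective_imp_surjective[OF linS] by blast
  then obtain x where x: "v = S x" by (metis surjD)
  have vn: "metric p v n = 0"
    by (simp add: vm n(1) c_def)
  have vL: "metric p v (L w) = 0" for w
    by (simp add: vm n(2) m(2))
  have "metric p v v = metric p v (S x)" using x by simp
  also have "\<dots> = 0" by (simp add: S_def lin vn vL)
  finally have "v = 0" using metric_self_eq_0[OF p] by blast
  then have mc: "m = c *\<^sub>R n" by (simp add: v_def)
  have "c * c = 1" using m(1) n(1) by (simp add: mc lin metric_commute[of p "c *\<^sub>R n"])
  then have "c = 1 \<or> c = -1" by (simp add: square_eq_1_iff)
  then show ?thesis using mc by auto
qed

section \<open>The translating field along an orbit\<close>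

text \<open>The field \<open>k\<close> pulled back by the rotation of angle \<open>t\<close> is \<open>(k \<circ> R) / R'\<close>.  For a Killing field
  it splits into a rotation-invariant part \<open>K\<close> and a part that the rotations turn with angle \<open>t\<close>.
  The condition says that the second part takes linearly independent values \<open>B\<close> and \<open>C\<close>; it excludes
  the multiples of the rotation field about the same centre.\<close>

definition rotates_nontrivially :: "real \<Rightarrow> real \<Rightarrow> (complex \<Rightarrow> complex) \<Rightarrow> bool" where
  "rotates_nontrivially x0 y0 k \<longleftrightarrow> (\<forall>w. Im w > 0 \<longrightarrow> (\<exists>K B C. Im (B * cnj C) \<noteq> 0 \<and>
     (\<forall>t. k (hyp_rotation x0 y0 t w) * rot_den x0 y0 t w ^ 2 = K + of_real (cos t) * B + of_real (sin t) * C)))"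

text \<open>Half-angle formulas.  The coefficients \<open>(1 - \<zeta>\<^sup>2) / 2\<close> and \<open>- \<zeta>\<close> are transvections, the infinitesimal
translations along geodesics through the centre.\<close>

lemma rot_den_squared:
  fixes x0 y0 w
  defines "\<zeta> \<equiv> (w - of_real x0) / of_real y0"
  shows "rot_den x0 y0 t w ^ 2 = (1 + \<zeta>^2) / 2 + of_real (cos t) * ((1 - \<zeta>^2) / 2) + of_real (sin t) * (- \<zeta>)"
    and "(of_real (cos (t/2)) * \<zeta> + of_real (sin (t/2))) * rot_den x0 y0 t w
       = of_real (cos t) * \<zeta> + of_real (sin t) * ((1 - \<zeta>^2) / 2)"
proof -
  define c s where "c = complex_of_real (cos (t/2))" and "s = complex_of_real (sin (t/2))"
  have d: "rot_den x0 y0 t w = c - s * \<zeta>" by (simp add: rot_den_def c_def s_def \<zeta>_def)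
  have one: "c^2 + s^2 = 1" by (simp add: c_def s_def sin_cos_squared_complex)
  have ct: "complex_of_real (cos t) = c^2 - s^2" using cos_double[of "t/2"] by (simp add: c_def s_def)
  have st: "complex_of_real (sin t) = 2 * s * c" using sin_double[of "t/2"] by (simp add: c_def s_def)
  have "rot_den x0 y0 t w ^ 2 = ((c^2 + s^2) * (1 + \<zeta>^2)) / 2 + (c^2 - s^2) * ((1 - \<zeta>^2) / 2) + 2 * s * c * (- \<zeta>)"
    unfolding d by (simp add: field_simps power2_eq_square)
  then show "rot_den x0 y0 t w ^ 2 = (1 + \<zeta>^2) / 2 + of_real (cos t) * ((1 - \<zeta>^2) / 2) + of_real (sin t) * (- \<zeta>)"
    by (simp only: one ct st mult_1_left)
  have "(c * \<zeta> + s) * (c - s * \<zeta>) = (c^2 - s^2) * \<zeta> + 2 * s * c * ((1 - \<zeta>^2) / 2)"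
    by (simp add: field_simps power2_eq_square)
  then show "(of_real (cos (t/2)) * \<zeta> + of_real (sin (t/2))) * rot_den x0 y0 t w
       = of_real (cos t) * \<zeta> + of_real (sin t) * ((1 - \<zeta>^2) / 2)"
    by (simp only: d ct st c_def s_def)
qed

lemma Im_transvections:
  "Im ((1 - \<zeta>^2) / 2 * cnj (- \<zeta>)) = Im \<zeta> * (1 + (norm \<zeta>)\<^sup>2) / 2"
proof -
  have "Im ((1 - \<zeta>^2) / 2 * cnj (- \<zeta>)) = Im \<zeta> * (1 + ((Re \<zeta>)^2 + (Im \<zeta>)^2)) / 2"
    by (simp add: power2_eq_square field_simps)
  then show ?thesis by (simp add: cmod_power2)
qed

lemma parabolic_rotates_nontrivially:
  assumes "y0 > 0" shows "rotates_nontrivially x0 y0 (\<lambda>w. 1)"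
  unfolding rotates_nontrivially_def
proof (intro allI impI)
  fix w assume "Im w > 0"
  define \<zeta> where "\<zeta> = (w - of_real x0) / of_real y0"
  have "Im \<zeta> > 0" using \<open>Im w > 0\<close> assms by (simp add: \<zeta>_def)
  then have "Im ((1 - \<zeta>^2) / 2 * cnj (- \<zeta>)) > 0"
    unfolding Im_transvections by (intro divide_pos_pos mult_pos_pos) (auto intro: add_pos_nonneg)
  then show "\<exists>K B C. Im (B * cnj C) \<noteq> 0 \<and>
     (\<forall>t. 1 * rot_den x0 y0 t w ^ 2 = K + of_real (cos t) * B + of_real (sin t) * C)"
    using rot_den_squared(1)[where ?w = w and ?x0.0 = x0 and ?y0.0 = y0] unfolding \<zeta>_def mult_1_left
    by (metis less_irrefl)
qed

text \<open>The dilation field is \<open>x0\<close> times the parabolic field plus the dilation field about \<open>x0\<close>.  Its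
pair \<open>(B', C')\<close> therefore arises from the parabolic pair \<open>(B, C)\<close> by a rotation and a scaling, of
determinant \<open>x0\<^sup>2 + y0\<^sup>2\<close>.\<close>

lemma hyperbolic_rotates_nontrivially:
  assumes "y0 > 0" shows "rotates_nontrivially x0 y0 (\<lambda>w. w)"
  unfolding rotates_nontrivially_def
proof (intro allI impI)
  fix w assume w: "Im w > 0"
  define \<zeta> where "\<zeta> = (w - of_real x0) / of_real y0"
  define B C where "B = (1 - \<zeta>^2) / 2" and "C = - \<zeta>"
  have "Im \<zeta> > 0" using w assms by (simp add: \<zeta>_def)
  then have pos: "Im (B * cnj C) > 0"
    unfolding Im_transvections B_def C_def by (intro divide_pos_pos mult_pos_pos) (auto intro: add_pos_nonneg)
  define B' C' where "B' = of_real x0 * B - of_real y0 * C" and "C' = of_real x0 * C + of_real y0 * B"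
  have "Im (B' * cnj C') = (x0^2 + y0^2) * Im (B * cnj C)"
    by (simp add: B'_def C'_def power2_eq_square algebra_simps)
  moreover have "x0^2 + y0^2 > 0" using assms by (simp add: add_nonneg_pos)
  ultimately have "Im (B' * cnj C') \<noteq> 0" using pos by (metis mult_pos_pos less_irrefl)
  moreover have "hyp_rotation x0 y0 t w * rot_den x0 y0 t w ^ 2
      = of_real x0 * ((1 + \<zeta>^2) / 2) + of_real (cos t) * B' + of_real (sin t) * C'" for t
  proof -
    define d e where "d = rot_den x0 y0 t w" and "e = of_real (cos (t/2)) * \<zeta> + of_real (sin (t/2))"
    have d0: "d \<noteq> 0" using rot_den_nonzero[OF assms w] by (simp add: d_def)
    have "hyp_rotation x0 y0 t w * d ^ 2 = (of_real x0 + of_real y0 * (e / d)) * d ^ 2"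
      by (simp add: hyp_rotation_eq d_def e_def \<zeta>_def)
    also have "\<dots> = of_real x0 * d ^ 2 + of_real y0 * (e * d)"
      using d0 by (simp add: distrib_right power2_eq_square)
    also have "\<dots> = of_real x0 * ((1 + \<zeta>^2) / 2 + of_real (cos t) * B + of_real (sin t) * C)
        + of_real y0 * (of_real (cos t) * (- C) + of_real (sin t) * B)"
    proof -
      have "d ^ 2 = (1 + \<zeta>^2) / 2 + of_real (cos t) * B + of_real (sin t) * C"
        unfolding d_def B_def C_def \<zeta>_def by (rule rot_den_squared(1))
      moreover have "e * d = of_real (cos t) * (- C) + of_real (sin t) * B"
        unfolding d_def e_def B_def C_def minus_minus \<zeta>_def by (rule rot_den_squared(2))
      ultimately show ?thesis by (simp only:)
    qed
    also have "\<dots> = of_real x0 * ((1 + \<zeta>^2) / 2) + of_real (cos t) * B' + of_real (sin t) * C'"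
      by (simp add: B'_def C'_def algebra_simps)
    finally show ?thesis unfolding d_def .
  qed
  ultimately show "\<exists>K B C. Im (B * cnj C) \<noteq> 0 \<and>
     (\<forall>t. hyp_rotation x0 y0 t w * rot_den x0 y0 t w ^ 2 = K + of_real (cos t) * B + of_real (sin t) * C)"
    by blast
qed

text \<open>Comparing \<open>t\<close> with \<open>- t\<close> isolates \<open>c\<close>, and comparing it with \<open>0\<close> then isolates \<open>b\<close>.\<close>

lemma trig_constant_near_0:
  fixes a b c :: real
  assumes e: "e > 0" and eq: "\<And>t. \<bar>t\<bar> < e \<Longrightarrow> a + cos t * b + sin t * c = a + b"
  shows "b = 0 \<and> c = 0"
proof -
  define t where "t = min (e / 2) 1"
  have t: "0 < t" "t < pi" "\<bar>t\<bar> < e" "\<bar>-t\<bar> < e" using e pi_gt3 by (auto simp: t_def min_def)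
  have s: "sin t > 0" using sin_gt_zero t by blast
  then have "cos t \<noteq> 1" using cos_one_sin_zero[of t] by auto
  moreover have "sin t * c = 0" "(cos t - 1) * b = 0"
    using eq[OF t(3)] eq[OF t(4)] by (simp_all add: algebra_simps)
  ultimately show ?thesis using s by simp
qed

lemma complex_orthogonal_to_basis:
  assumes "Re (n * cnj B) = 0" "Re (n * cnj C) = 0" "Im (B * cnj C) \<noteq> 0"
  shows "n = 0"
proof -
  have 1: "Re n * Re B + Im n * Im B = 0" "Re n * Re C + Im n * Im C = 0"
    "Im B * Re C - Re B * Im C \<noteq> 0" using assms by simp_all
  have "Re n * (Im B * Re C - Re B * Im C)
      = Im B * (Re n * Re C + Im n * Im C) - Im C * (Re n * Re B + Im n * Im B)"
    "Im n * (Im B * Re C - Re B * Im C)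
      = Re C * (Re n * Re B + Im n * Im B) - Re B * (Re n * Re C + Im n * Im C)"
    by (simp_all add: algebra_simps)
  then have "Re n * (Im B * Re C - Re B * Im C) = 0" "Im n * (Im B * Re C - Re B * Im C) = 0"
    by (simp_all only: 1(1,2) mult_zero_right diff_self)
  then show ?thesis using 1(3) by (simp add: complex_eq_iff)
qed

section \<open>Rotational translators are horizontal\<close>

lemma smooth_immersion_on_subset:
  "smooth_immersion_on D X \<Longrightarrow> U \<subseteq> D \<Longrightarrow> smooth_immersion_on U X"
  unfolding smooth_immersion_on_def Ck_on_iff_Ck using Ck_subset by blast

lemma smooth_immersion_on_cong_open:
  assumes "open U" "\<And>u. u \<in> U \<Longrightarrow> X u = Y u" "smooth_immersion_on U X"
  shows "smooth_immersion_on U Y"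
  unfolding smooth_immersion_on_def Ck_on_iff_Ck
proof (intro conjI allI ballI)
  show "Ck k U Y" for k
    by (rule Ck_cong[OF assms(1,2)]) (use assms(3) in \<open>auto simp: smooth_immersion_on_def Ck_on_iff_Ck\<close>)
  show "inj (frechet_derivative Y (at u))" if "u \<in> U" for u
    using assms(3) that unfolding smooth_immersion_on_def
    by (simp add: frechet_derivative_cong_open[OF assms(1) that assms(2), symmetric])
qed

lemma surface_chart_restrict:
  assumes ch: "surface_chart M f D \<phi>" and U: "open U" "U \<subseteq> D"
  shows "surface_chart M f U \<phi>"
proof -
  have "smooth_immersion_on U (f \<circ> \<phi>)"
    using ch U(2) smooth_immersion_on_subset by (auto simp: surface_chart_def)
  then show ?thesis
    using surface_chart_reparam[OF ch U(1), of "\<lambda>u. u"] U(2) by (simp add: o_def)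
qed

lemma unit_normal_orthogonal:
  assumes N: "unit_normal M f N" and ch: "surface_chart M f D \<phi>" and u: "u \<in> D"
  shows "metric (f (\<phi> u)) (N (\<phi> u)) (frechet_derivative (f \<circ> \<phi>) (at u) v) = 0"
proof -
  have D: "open D" using ch by (simp add: surface_chart_def)
  have lin: "linear (frechet_derivative (f \<circ> \<phi>) (at u))"
    using has_derivative_linear[OF has_derivative_frechet[OF surface_chart_differentiable[OF ch] D u]] .
  have "linear (\<lambda>v. metric (f (\<phi> u)) (N (\<phi> u)) (frechet_derivative (f \<circ> \<phi>) (at u) v))"
    using linear_compose[OF lin linear_metric] by (simp add: o_def)
  from linear_vec_expand[OF this, of v] show ?thesis
    using N ch u unfolding unit_normal_def partial_deriv_def by simp
qed

text \<open>The lifted rotations turn a chart into another chart, with the rotated immersion.  Isometries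
preserve mean curvature, so the translator equation makes the inner product of the fixed normal
with the pulled back field independent of small \<open>t\<close>.  Being a trigonometric polynomial in \<open>t\<close>, it has
vanishing oscillating coefficients, and the horizontal part of the normal is orthogonal to two
independent horizontal vectors.\<close>

lemma unit_normal_vertical_off_axis:
  assumes surf: "immersed_surface M f" and y0: "y0 > 0"
    and rot: "\<And>t. vertical_rotation x0 y0 t ` f ` topspace M = f ` topspace M"
    and N: "unit_normal M f N"
    and eq: "\<And>D \<phi> u. surface_chart M f D \<phi> \<Longrightarrow> u \<in> D \<Longrightarrow>
        mean_curvature (f \<circ> \<phi>) (N (\<phi> u)) u = metric (f (\<phi> u)) (N (\<phi> u)) (V (f (\<phi> u)))"
    and V: "\<And>p. V p = hpoint (k (hpart p)) 0" and k: "rotates_nontrivially x0 y0 k"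
    and ch: "surface_chart M f D \<phi>" and u0: "u0 \<in> D" and off: "hpart (f (\<phi> u0)) \<noteq> Complex x0 y0"
  shows "hpart (N (\<phi> u0)) = 0"
proof -
  define X p n where "X = f \<circ> \<phi>" and "p = f (\<phi> u0)" and "n = N (\<phi> u0)"
  have D: "open D" using ch by (simp add: surface_chart_def)
  have XH: "X ` D \<subseteq> H2R" using chart_image_H2R[OF surf y0 rot ch] by (simp add: X_def)
  have p: "p \<in> H2R" using XH u0 by (auto simp: p_def X_def)
  have smX: "smooth_immersion_on D X" using ch by (simp add: surface_chart_def X_def)
  have dX: "X differentiable_on D" using surface_chart_differentiable[OF ch] by (simp add: X_def)
  define L where "L = frechet_derivative X (at u0)"
  have L: "linear L" "inj L"
    using has_derivative_linear[OF has_derivative_frechet[OF dX D u0]] smX u0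
    by (auto simp: L_def smooth_immersion_on_def)
  have n: "metric p n n = 1" "\<And>w. metric p n (L w) = 0"
    using N surface_chart_subset_topspace[OF ch u0] unit_normal_orthogonal[OF N ch u0]
    by (auto simp: unit_normal_def p_def n_def L_def X_def)
  obtain K B C where BC: "Im (B * cnj C) \<noteq> 0" and kt: "\<And>t. k (hyp_rotation x0 y0 t (hpart p)) *
      rot_den x0 y0 t (hpart p) ^ 2 = K + of_real (cos t) * B + of_real (sin t) * C"
    using k p unfolding rotates_nontrivially_def H2R_iff by meson
  define F where "F q = Re (hpart n * cnj q) / (p $ 2)\<^sup>2" for q
  have F: "metric p n (hpoint q 0) = F q" for q by (simp add: F_def metric_eq)
  have Flin: "F (a + of_real r * b + of_real s * c) = F a + r * F b + s * F c" for a b c r s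
    by (simp add: F_def algebra_simps add_divide_distrib diff_divide_distrib)
  obtain U \<epsilon> where U: "open U" "u0 \<in> U" "U \<subseteq> D" "\<epsilon> > 0"
    and \<psi>: "\<forall>t. \<bar>t\<bar> < \<epsilon> \<longrightarrow> (\<exists>\<psi>. continuous_on U \<psi> \<and> inj_on \<psi> U \<and> \<psi> ` U \<subseteq> D \<and>
        (\<forall>u\<in>U. f (\<phi> (\<psi> u)) = vertical_rotation x0 y0 t (f (\<phi> u))))"
    by (rule local_rotation_invariance[OF surf y0 rot ch u0 off]) (rule that; assumption)
  have XU: "X ` U \<subseteq> H2R" using XH U(3) by blast
  have CU: "Ck 2 U X" using Ck_subset[OF surface_chart_Ck[OF ch] U(3)] by (simp add: X_def)
  have dXU: "X differentiable_on U" using differentiable_on_subset[OF dX U(3)] .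
  have const: "F (K + of_real (cos t) * B + of_real (sin t) * C) = metric p n (V p)" if t: "\<bar>t\<bar> < \<epsilon>" for t
  proof -
    obtain \<psi> where \<psi>: "continuous_on U \<psi>" "inj_on \<psi> U" "\<psi> ` U \<subseteq> D"
      and rt: "\<And>u. u \<in> U \<Longrightarrow> f (\<phi> (\<psi> u)) = vertical_rotation x0 y0 t (f (\<phi> u))"
      using \<psi> t by blast
    define R T where "R = vertical_rotation x0 y0 t" and "T = rotation_diff x0 y0 t p"
    define \<phi>' where "\<phi>' = \<phi> \<circ> \<psi>"
    have Yeq: "(f \<circ> \<phi>') u = (R \<circ> X) u" if "u \<in> U" for u
      using rt[OF that] by (simp add: \<phi>'_def R_def X_def)
    have "smooth_immersion_on U (R \<circ> X)"
      unfolding R_def by (rule smooth_immersion_rotation_comp[OF y0 U(1) XU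
            smooth_immersion_on_subset[OF smX U(3)]])
    from smooth_immersion_on_cong_open[OF U(1) _ this, of "f \<circ> \<phi>'"]
    have "smooth_immersion_on U (f \<circ> \<phi>')" using Yeq by metis
    then have ch': "surface_chart M f U \<phi>'"
      unfolding \<phi>'_def by (rule surface_chart_reparam[OF ch U(1) \<psi>])
    define n' where "n' = N (\<phi>' u0)"
    have fp: "f (\<phi>' u0) = R p" using Yeq[OF U(2)] by (simp add: X_def p_def)
    have Rp: "R p \<in> H2R" unfolding R_def by (rule vertical_rotation_in_H2R[OF y0 p])
    have iso: "metric (R p) (T v) (T w) = metric p v w" for v w
      unfolding R_def T_def by (rule metric_rotation_diff[OF y0 p])
    have "frechet_derivative (f \<circ> \<phi>') (at u0) = frechet_derivative (R \<circ> X) (at u0)"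
      by (rule frechet_derivative_cong_open[OF U(1,2)]) (rule Yeq)
    also have "\<dots> = rotation_diff x0 y0 t (X u0) \<circ> frechet_derivative X (at u0)"
      unfolding R_def by (rule rotation_comp_derivative[OF y0 U(1) XU dXU U(2)])
    finally have dY: "frechet_derivative (f \<circ> \<phi>') (at u0) = T \<circ> L"
      by (simp add: T_def L_def X_def p_def)
    have "n' = T n \<or> n' = - T n"
    proof (rule unit_normal_unique[OF Rp, of "T \<circ> L"])
      show "linear (T \<circ> L)" unfolding T_def by (rule linear_compose[OF L(1) rotation_diff_linear])
      show "inj (T \<circ> L)" unfolding T_def by (rule inj_compose[OF rotation_diff_inj[OF y0 p] L(2)])
      show "metric (R p) (T n) (T n) = 1" "metric (R p) (T n) ((T \<circ> L) w) = 0" for w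
        by (simp_all add: iso n)
      show "metric (R p) n' n' = 1"
        using N surface_chart_subset_topspace[OF ch' U(2)] by (simp add: unit_normal_def n'_def flip: fp)
      show "metric (R p) n' ((T \<circ> L) w) = 0" for w
        using unit_normal_orthogonal[OF N ch' U(2), of w] by (simp only: dY n'_def flip: fp)
    qed
    \<comment> \<open>The two sides of the translator equation change sign together, so the sign is immaterial.\<close>
    moreover have "mean_curvature (f \<circ> \<phi>') n' u0 = metric (R p) n' (V (R p))"
      using eq[OF ch' U(2)] by (simp add: n'_def flip: fp)
    ultimately have "mean_curvature (f \<circ> \<phi>') (T n) u0 = metric (R p) (T n) (V (R p))"
      by (auto simp: mean_curvature_uminus metric_uminus_left)
    moreover have "mean_curvature (f \<circ> \<phi>') (T n) u0 = mean_curvature (R \<circ> X) (T n) u0"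
      by (rule mean_curvature_cong_open[OF U(1,2)]) (rule Yeq)
    moreover have "mean_curvature (R \<circ> X) (T n) u0 = mean_curvature X n u0"
      using mean_curvature_rotation_comp[OF y0 U(1) XU CU U(2), of x0 t n]
      by (simp add: R_def T_def X_def p_def)
    moreover have "mean_curvature X n u0 = metric p n (V p)"
      using eq[OF ch u0] by (simp add: X_def n_def p_def)
    moreover have "V (R p) = T (hpoint (K + of_real (cos t) * B + of_real (sin t) * C) 0)"
    proof -
      have "rot_den x0 y0 t (hpart p) \<noteq> 0" using rot_den_nonzero[OF y0] p by (simp add: H2R_iff)
      then have cancel: "inverse (rot_den x0 y0 t (hpart p)) ^ 2 * (q * rot_den x0 y0 t (hpart p) ^ 2) = q" for q
        by (simp add: field_simps)
      show ?thesis
        unfolding V R_def T_def rotation_diff_def hpart_hpoint hpoint_nth vertical_rotation_eq kt[symmetric]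
          cancel by (rule refl)
    qed
    ultimately show ?thesis by (simp add: iso F)
  qed
  have "F K + cos t * F B + sin t * F C = F K + F B" if "\<bar>t\<bar> < \<epsilon>" for t
    using const[OF that] const[of 0] U(4) Flin[of K "cos t" B "sin t" C] Flin[of K 1 B 0 C] by simp
  from trig_constant_near_0[OF U(4) this] have "F B = 0" "F C = 0" by auto
  moreover have "p $ 2 \<noteq> 0" using p by (simp add: H2R_def)
  ultimately show ?thesis
    using complex_orthogonal_to_basis[OF _ _ BC, of "hpart n"] by (simp add: F_def n_def)
qed

text \<open>Off the axis the height is critical because the normal is vertical.  The points of the surface off
the axis are dense and the differential of the height is continuous.\<close>

lemma height_locally_constant:
  assumes "immersed_surface M f" "y0 > 0"
    and "\<And>t. vertical_rotation x0 y0 t ` f ` topspace M = f ` topspace M"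
    and N: "unit_normal M f N"
    and "\<And>D \<phi> u. surface_chart M f D \<phi> \<Longrightarrow> u \<in> D \<Longrightarrow>
        mean_curvature (f \<circ> \<phi>) (N (\<phi> u)) u = metric (f (\<phi> u)) (N (\<phi> u)) (V (f (\<phi> u)))"
    and "\<And>p. V p = hpoint (k (hpart p)) 0" "rotates_nontrivially x0 y0 k"
    and ch: "surface_chart M f D \<phi>" and u: "u \<in> D"
  shows "frechet_derivative (\<lambda>u. f (\<phi> u) $ 3) (at u) = (\<lambda>v. 0)"
proof -
  define X where "X = f \<circ> \<phi>"
  have D: "open D" using ch by (simp add: surface_chart_def)
  have CX: "Ck 1 D X" using surface_chart_Ck[OF ch] by (simp add: X_def)
  then have dX: "X differentiable_on D" and cX: "\<And>i. continuous_on D (partial_deriv i X)" by auto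
  have off: "partial_deriv i X w $ 3 = 0" if w: "w \<in> D" and o: "hpart (X w) \<noteq> Complex x0 y0" for w i
  proof -
    have h: "hpart (N (\<phi> w)) = 0"
      using unit_normal_vertical_off_axis[OF assms(1-8) w] o by (simp add: X_def)
    have "metric (f (\<phi> w)) (N (\<phi> w)) (N (\<phi> w)) = 1"
      using N surface_chart_subset_topspace[OF ch w] by (simp add: unit_normal_def)
    then have "N (\<phi> w) $ 3 \<noteq> 0" by (auto simp: metric_eq h)
    moreover have "metric (f (\<phi> w)) (N (\<phi> w)) (partial_deriv i X w) = 0"
      using N ch w by (simp add: unit_normal_def X_def)
    ultimately show ?thesis by (simp add: metric_eq h)
  qed
  \<comment> \<open>An immersion meets the axis in a set with empty interior.\<close>
  have zero: "partial_deriv i X u $ 3 = 0" for i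
  proof (rule ccontr)
    assume nz: "partial_deriv i X u $ 3 \<noteq> 0"
    have "continuous_on D (\<lambda>w. partial_deriv i X w $ 3)" by (intro continuous_intros cX)
    from continuous_open_preimage[OF this D, of "- {0}"]
    have oO: "open {w \<in> D. partial_deriv i X w $ 3 \<noteq> 0}" (is "open ?O")
      by (simp add: vimage_def Int_def open_Compl)
    have uO: "u \<in> ?O" using u nz by simp
    have "hpart (X w) = Complex x0 y0" if "w \<in> ?O" for w using off that by blast
    from frechet_derivative_cong_open[OF oO uO this]
    have h0: "frechet_derivative (\<lambda>w. hpart (X w)) (at u) = (\<lambda>v. 0)" by simp
    define L where "L = frechet_derivative X (at u)"
    have dXu: "(X has_derivative L) (at u)" unfolding L_def by (rule has_derivative_frechet[OF dX D u])
    have hL: "hpart (L v) = 0" for v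
      using h0 frechet_derivative_at[OF bounded_linear.has_derivative[OF bounded_linear_hpart dXu]]
      by metis
    have lin: "linear L" using has_derivative_linear[OF dXu] .
    have inj: "inj L" using ch u by (auto simp: surface_chart_def smooth_immersion_on_def L_def X_def)
    have "L (L (axis 2 1) $ 3 *\<^sub>R axis 1 1 - L (axis 1 1) $ 3 *\<^sub>R axis 2 1) = 0"
      using hL[of "axis 1 1"] hL[of "axis 2 1"]
      by (simp add: linear_diff[OF lin] linear_cmul[OF lin] vec_eq_iff forall_3 complex_eq_iff)
    then have *: "L (axis 2 1) $ 3 *\<^sub>R axis 1 1 - L (axis 1 1) $ 3 *\<^sub>R axis 2 1 = (0 :: real^2)"
      using inj linear_injective_0[OF lin] by blast
    have "L (axis 1 1) $ 3 = 0"
      using arg_cong[OF *, of "\<lambda>x. x $ 2"] by (simp add: axis_def)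
    then have "L (axis 1 1) = 0"
      using hL[of "axis 1 1"] by (simp add: vec_eq_iff forall_3 complex_eq_iff)
    then have "axis 1 1 = (0 :: real^2)" using inj linear_injective_0[OF lin] by blast
    then show False by (simp add: axis_eq_0_iff)
  qed
  have der: "((\<lambda>u. X u $ 3) has_derivative (\<lambda>v. frechet_derivative X (at u) v $ 3)) (at u)"
    using bounded_linear.has_derivative[OF bounded_linear_vec_nth has_derivative_frechet[OF dX D u]] .
  have "frechet_derivative X (at u) v $ 3 = 0" for v
    using linear_vec_expand[OF has_derivative_linear[OF der], of v] zero
    by (simp add: partial_deriv_def)
  then show ?thesis
    using frechet_derivative_at[OF der] by (simp add: X_def)
qed

text \<open>The height is locally constant, hence constant by connectedness.  An immersion into a slice is a
map between surfaces with bijective differential, so its image is open in the slice.\<close>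

lemma rotational_translator_in_slice:
  assumes M: "connected_space M" and tr: "translator V M f" and y0: "y0 > 0"
    and rot: "\<And>t. vertical_rotation x0 y0 t ` f ` topspace M = f ` topspace M"
    and V: "\<And>p. V p = hpoint (k (hpart p)) 0" and k: "rotates_nontrivially x0 y0 k"
  shows "\<exists>z0. openin (top_of_set (slice z0)) (f ` topspace M)"
proof (cases "topspace M = {}")
  case True then show ?thesis by simp
next
  case False
  then obtain m0 where m0: "m0 \<in> topspace M" by blast
  define z0 where "z0 = f m0 $ 3"
  have surf: "immersed_surface M f" using tr by (simp add: translator_def)
  obtain N where N: "unit_normal M f N" and eq: "\<And>D \<phi> u. surface_chart M f D \<phi> \<Longrightarrow> u \<in> D \<Longrightarrow>
        mean_curvature (f \<circ> \<phi>) (N (\<phi> u)) u = metric (f (\<phi> u)) (N (\<phi> u)) (V (f (\<phi> u)))"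
    using tr unfolding translator_def by metis
  have loc: "\<exists>W. openin M W \<and> m \<in> W \<and> (\<forall>m'\<in>W. f m' $ 3 = f m $ 3)" if m: "m \<in> topspace M" for m
  proof -
    obtain D \<phi> where ch: "surface_chart M f D \<phi>" and "m \<in> \<phi> ` D"
      using surf m unfolding immersed_surface_def by metis
    then obtain u where u: "u \<in> D" "m = \<phi> u" by blast
    have D: "open D" using ch by (simp add: surface_chart_def)
    then obtain r where r: "r > 0" "ball u r \<subseteq> D" using u(1) open_contains_ball by blast
    have dz: "(\<lambda>u. f (\<phi> u) $ 3) differentiable_on D"
      using Ck_linear[OF D bounded_linear_vec_nth surface_chart_Ck[OF ch, of 1], of 3] by simp
    have "\<exists>c. \<forall>w\<in>ball u r. f (\<phi> w) $ 3 = c"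
    proof (rule has_derivative_zero_constant[OF convex_ball])
      fix w assume "w \<in> ball u r"
      then have w: "w \<in> D" using r by blast
      show "((\<lambda>u. f (\<phi> u) $ 3) has_derivative (\<lambda>h. 0)) (at w within ball u r)"
        using has_derivative_frechet[OF dz D w] height_locally_constant[OF surf y0 rot N eq V k ch w]
        by (simp add: has_derivative_at_withinI)
    qed
    moreover have "u \<in> ball u r" using r by simp
    ultimately have "\<forall>m'\<in>\<phi> ` ball u r. f m' $ 3 = f m $ 3" unfolding u(2) by (metis imageE)
    moreover have "openin M (\<phi> ` ball u r)"
      using surface_chart_restrict[OF ch open_ball r(2)] by (simp add: surface_chart_def)
    moreover have "m \<in> \<phi> ` ball u r" using u(2) r(1) by simp
    ultimately show ?thesis by (intro exI[of _ "\<phi> ` ball u r"] conjI)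
  qed
  have op: "openin M {m \<in> topspace M. P (f m $ 3)}" for P
  proof (subst openin_subopen, intro ballI)
    fix m assume m: "m \<in> {m \<in> topspace M. P (f m $ 3)}"
    then have "m \<in> topspace M" by simp
    from loc[OF this] obtain W where W: "openin M W" "m \<in> W" "\<forall>m'\<in>W. f m' $ 3 = f m $ 3"
      by (elim exE conjE)
    have "W \<subseteq> {m \<in> topspace M. P (f m $ 3)}"
      using W(3) m openin_subset[OF W(1)] by auto
    then show "\<exists>T. openin M T \<and> m \<in> T \<and> T \<subseteq> {m \<in> topspace M. P (f m $ 3)}"
      using W(1,2) by (intro exI[of _ W] conjI)
  qed
  have z: "f m $ 3 = z0" if m: "m \<in> topspace M" for m
  proof (rule ccontr)
    assume "f m $ 3 \<noteq> z0"
    then show False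
      using connected_spaceD[OF M op[of "\<lambda>c. c = z0"] op[of "\<lambda>c. c \<noteq> z0"]] m m0
      by (auto simp: z0_def)
  qed
  have "openin (top_of_set (slice z0)) (f ` topspace M)"
  proof (subst openin_subopen, intro ballI)
    fix q assume "q \<in> f ` topspace M"
    then obtain m where m: "m \<in> topspace M" "q = f m" by blast
    obtain D \<phi> where ch: "surface_chart M f D \<phi>" and "m \<in> \<phi> ` D"
      using surf m unfolding immersed_surface_def by metis
    then obtain u where u: "u \<in> D" "m = \<phi> u" by blast
    define X where "X = f \<circ> \<phi>"
    have D: "open D" using ch by (simp add: surface_chart_def)
    have dX: "X differentiable_on D" using surface_chart_differentiable[OF ch] by (simp add: X_def)
    have XM: "X w \<in> f ` topspace M" "X w $ 3 = z0" if "w \<in> D" for w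
      using surface_chart_subset_topspace[OF ch that] z by (auto simp: X_def)
    define L where "L = frechet_derivative X (at u)"
    have L: "(X has_derivative L) (at u)" unfolding L_def by (rule has_derivative_frechet[OF dX D u(1)])
    have L3: "L v $ 3 = 0" for v
    proof -
      have "((\<lambda>w. X w $ 3) has_derivative (\<lambda>v. L v $ 3)) (at u)"
        using bounded_linear.has_derivative[OF bounded_linear_vec_nth L] .
      from frechet_derivative_at[OF this] frechet_derivative_cong_open[OF D u(1), of "\<lambda>w. X w $ 3" "\<lambda>_. z0"] XM(2)
      show ?thesis by (simp add: fun_eq_iff)
    qed
    have inj: "inj L" using ch u by (auto simp: surface_chart_def smooth_immersion_on_def L_def X_def)
    have L0: "v = 0" if "L v $ 1 = 0" "L v $ 2 = 0" for v
    proof -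
      have "L v = 0" using that L3 by (simp add: vec_eq_iff forall_3)
      then show ?thesis using inj linear_injective_0[OF has_derivative_linear[OF L]] by blast
    qed
    have c: "continuous_on D (\<lambda>w. X w $ i)" for i
      by (intro continuous_intros differentiable_imp_continuous_on[OF dX])
    obtain W where W: "open W" "pair2 (X u $ 1) (X u $ 2) \<in> W"
      "W \<subseteq> (\<lambda>w. pair2 (X w $ 1) (X w $ 2)) ` D"
      using injective_derivative_open_image[OF D u(1) c[of 1] c[of 2]
          bounded_linear.has_derivative[OF bounded_linear_vec_nth L]
          bounded_linear.has_derivative[OF bounded_linear_vec_nth L] L0] by blast
    have "continuous_on UNIV (\<lambda>p::real^3. pair2 (p $ 1) (p $ 2))" by (intro continuous_intros)
    then have oT: "open {p::real^3. pair2 (p $ 1) (p $ 2) \<in> W}" (is "open ?T")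
      using W(1) by (simp add: continuous_on_open_vimage vimage_def)
    have "slice z0 \<inter> ?T \<subseteq> f ` topspace M"
    proof
      fix p assume p: "p \<in> slice z0 \<inter> ?T"
      then obtain w where w: "w \<in> D" "p $ 1 = X w $ 1" "p $ 2 = X w $ 2"
        using W(3) by (auto simp: pair2_eq_iff)
      then have "p = X w" using p XM(2)[OF w(1)] by (simp add: vec_eq_iff forall_3 slice_def)
      then show "p \<in> f ` topspace M" using XM(1)[OF w(1)] by simp
    qed
    moreover have "q \<in> slice z0 \<inter> ?T"
      using W(2) z[OF m(1)] surf m u(2) by (auto simp: slice_def X_def immersed_surface_def)
    ultimately show "\<exists>T. openin (top_of_set (slice z0)) T \<and> q \<in> T \<and> T \<subseteq> f ` topspace M"
      using oT by (intro exI[of _ "slice z0 \<inter> ?T"]) (auto intro: openin_open_Int)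
  qed
  then show ?thesis ..
qed

section \<open>Slices\<close>

lemma height_constant_imp_partial_deriv_horizontal:
  fixes X :: "real^2 \<Rightarrow> real^3"
  assumes "open D" "X differentiable_on D" "\<And>u. u \<in> D \<Longrightarrow> X u $ 3 = c" "u \<in> D"
  shows "partial_deriv a X u $ 3 = 0"
proof -
  have "((\<lambda>w. X w $ 3) has_derivative (\<lambda>v. frechet_derivative X (at u) v $ 3)) (at u)"
    using bounded_linear.has_derivative[OF bounded_linear_vec_nth
        has_derivative_frechet[OF assms(2,1,4)]] .
  from partial_deriv_eq[OF this, of a] partial_deriv_cong_open[OF assms(1,4), of "\<lambda>w. X w $ 3" "\<lambda>_. c" a]
  show ?thesis using assms(3) by (simp add: partial_deriv_def)
qed

definition slice_param :: "real \<Rightarrow> real^2 \<Rightarrow> real^3" where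
  "slice_param z0 u = u $ 1 *\<^sub>R axis 1 1 + u $ 2 *\<^sub>R axis 2 1 + z0 *\<^sub>R axis 3 1"

lemma slice_param_nth [simp]:
  "slice_param z0 u $ 1 = u $ 1" "slice_param z0 u $ 2 = u $ 2" "slice_param z0 u $ 3 = z0"
  by (simp_all add: slice_param_def axis_def)

lemma slice_chart: "surface_chart (top_of_set (slice z0)) (\<lambda>p. p) {u. u $ 2 > 0} (slice_param z0)"
proof -
  define D :: "(real^2) set" where "D = {u. u $ 2 > 0}"
  have D: "open D" unfolding D_def by (intro open_Collect_less continuous_intros)
  have eq: "slice_param z0 u = p \<longleftrightarrow> u $ 1 = p $ 1 \<and> u $ 2 = p $ 2 \<and> z0 = p $ 3" for u p
    by (simp add: vec_eq_iff forall_3)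
  have im: "slice_param z0 ` D = slice z0"
  proof
    show "slice_param z0 ` D \<subseteq> slice z0" by (auto simp: D_def slice_def H2R_def)
    show "slice z0 \<subseteq> slice_param z0 ` D"
    proof
      fix p assume "p \<in> slice z0"
      then have "p = slice_param z0 (pair2 (p $ 1) (p $ 2))" "pair2 (p $ 1) (p $ 2) \<in> D"
        by (auto simp: slice_def H2R_def D_def vec_eq_iff forall_3)
      then show "p \<in> slice_param z0 ` D" by blast
    qed
  qed
  have "homeomorphic_maps (top_of_set D) (top_of_set (slice z0)) (slice_param z0)
      (\<lambda>p. pair2 (p $ 1) (p $ 2))"
    unfolding homeomorphic_maps_def
  proof (intro conjI ballI)
    show "continuous_map (top_of_set D) (top_of_set (slice z0)) (slice_param z0)"
      using im unfolding slice_param_def by (auto intro!: continuous_intros)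
    show "continuous_map (top_of_set (slice z0)) (top_of_set D) (\<lambda>p. pair2 (p $ 1) (p $ 2))"
      by (auto intro!: continuous_intros simp: D_def slice_def H2R_def)
  qed (auto simp: vec_eq_iff forall_2 forall_3 slice_def)
  then have "homeomorphic_map (top_of_set D) (top_of_set (slice z0)) (slice_param z0)"
    using homeomorphic_map_maps by blast
  moreover have "smooth_immersion_on D (slice_param z0)"
    unfolding smooth_immersion_on_def Ck_on_iff_Ck
  proof (intro conjI allI ballI)
    have "Ck k D (\<lambda>u::real^2. u)" for k
    proof -
      have "partial_deriv i (\<lambda>u::real^2. u) = (\<lambda>_. axis i 1)" for i
        by (auto simp: partial_deriv_def)
      then have "Ck (Suc k) D (\<lambda>u::real^2. u)"
        by (simp add: Ck_const differentiable_on_ident)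
      then show ?thesis by (rule Ck_Suc_imp_Ck)
    qed
    then have "Ck k D (\<lambda>u. (u :: real^2) $ i)" for k i by (rule Ck_linear[OF D bounded_linear_vec_nth])
    then show "Ck k D (slice_param z0)" for k
      unfolding slice_param_def[abs_def]
      by (intro Ck_add[OF D] Ck_const Ck_linear[OF D bounded_linear_scaleR_left])
    fix u
    have "(slice_param z0 has_derivative (\<lambda>v. v $ 1 *\<^sub>R axis 1 1 + v $ 2 *\<^sub>R axis 2 1)) (at u)"
      unfolding slice_param_def[abs_def] by (auto intro!: derivative_eq_intros)
    from frechet_derivative_at[OF this, symmetric]
    show "inj (frechet_derivative (slice_param z0) (at u))"
      by (auto intro!: injI simp: vec_eq_iff forall_2 forall_3 axis_def)
  qed
  ultimately show ?thesis
    using D openin_topspace[of "top_of_set (slice z0)"]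
    by (simp add: surface_chart_def im o_def subtopology_subtopology flip: D_def)
qed

lemma second_countable_euclidean:
  "second_countable (euclidean :: 'a::second_countable_topology topology)"
proof -
  obtain B :: "'a set set" where B: "countable B" "topological_basis B"
    using ex_countable_basis by blast
  show ?thesis
    unfolding second_countable_def
  proof (intro exI[of _ B] conjI ballI allI impI)
    show "openin euclidean V" if "V \<in> B" for V using topological_basis_open[OF B(2) that] by simp
    fix U and x :: 'a assume "openin euclidean U \<and> x \<in> U"
    then have U: "open U" "x \<in> U" by auto
    obtain V where "V \<in> B" "x \<in> V" "V \<subseteq> U" by (rule topological_basisE[OF B(2) U])
    then show "\<exists>V\<in>B. x \<in> V \<and> V \<subseteq> U" by blast
  qed (rule B(1))
qed

lemma immersed_surface_slice: "immersed_surface (top_of_set (slice z0)) (\<lambda>p. p)"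
  unfolding immersed_surface_def
proof (intro conjI ballI)
  show "Hausdorff_space (top_of_set (slice z0))"
    by (simp add: Hausdorff_space_subtopology)
  show "second_countable (top_of_set (slice z0))"
    by (simp add: second_countable_subtopology second_countable_euclidean)
  show "(\<lambda>p. p) ` topspace (top_of_set (slice z0)) \<subseteq> H2R" by (auto simp: slice_def)
  fix p assume "p \<in> topspace (top_of_set (slice z0))"
  then have "p = slice_param z0 (pair2 (p $ 1) (p $ 2))" "pair2 (p $ 1) (p $ 2) \<in> {u. u $ 2 > 0}"
    by (auto simp: slice_def H2R_def vec_eq_iff forall_3)
  then have "p \<in> slice_param z0 ` {u. u $ 2 > 0}" by blast
  then show "\<exists>D \<phi>. surface_chart (top_of_set (slice z0)) (\<lambda>p. p) D \<phi> \<and> p \<in> \<phi> ` D"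
    using slice_chart by blast
qed

text \<open>The vertical unit vector is a parallel normal field, so a slice is totally geodesic and both sides
of the translator equation vanish for every horizontal field.  The equation is checked in all
charts, and there only the vanishing of the height components of the derivatives is used.\<close>

lemma slice_translator:
  assumes V: "\<And>p. V p $ 3 = 0"
  shows "translator V (top_of_set (slice z0)) (\<lambda>p. p)"
  unfolding translator_def
proof (intro conjI exI[of _ "\<lambda>_. axis 3 1"] allI impI)
  have m3: "metric p (axis 3 1) v = v $ 3" for p v by (simp add: metric_def axis_def)
  have horizontal: "partial_deriv a ((\<lambda>p. p) \<circ> \<phi>) u $ 3 = 0"
    if ch: "surface_chart (top_of_set (slice z0)) (\<lambda>p. p) D \<phi>" and u: "u \<in> D" for D \<phi> u a
  proof (rule height_constant_imp_partial_deriv_horizontal[OF _ surface_chart_differentiable[OF ch] _ u])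
    show "open D" using ch by (simp add: surface_chart_def)
    show "((\<lambda>p. p) \<circ> \<phi>) w $ 3 = z0" if "w \<in> D" for w
      using surface_chart_subset_topspace[OF ch that] by (simp add: slice_def)
  qed
  show "immersed_surface (top_of_set (slice z0)) (\<lambda>p. p)" by (rule immersed_surface_slice)
  show "unit_normal (top_of_set (slice z0)) (\<lambda>p. p) (\<lambda>_. axis 3 1)"
    using horizontal by (auto simp: unit_normal_def m3)
  fix D \<phi> u assume *: "surface_chart (top_of_set (slice z0)) (\<lambda>p. p) D \<phi> \<and> u \<in> D"
  then have ch: "surface_chart (top_of_set (slice z0)) (\<lambda>p. p) D \<phi>" and u: "u \<in> D" by auto
  define X where "X = (\<lambda>p. p) \<circ> \<phi>"
  have Xu: "X u \<in> H2R" using surface_chart_subset_topspace[OF ch u] by (simp add: X_def slice_def)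
  have D: "open D" using ch by (simp add: surface_chart_def)
  have "Ck 2 D X" using surface_chart_Ck[OF ch] by (simp add: X_def)
  then have "partial_deriv b X differentiable_on D" for b by (simp add: numeral_2_eq_2)
  then have "partial_deriv a (partial_deriv b X) u $ 3 = 0" for a b
    by (rule height_constant_imp_partial_deriv_horizontal[OF D _ _ u, of _ 0])
      (use horizontal[OF ch] in \<open>simp add: X_def\<close>)
  then have "second_form X (axis 3 1) u = 0"
    by (simp add: second_form_def m3 cov_deriv_eq[of X, OF Xu] vec_eq_iff)
  then have "mean_curvature X (axis 3 1) u = 0"
    by (simp add: mean_curvature_def trace_def matrix_matrix_mult_def)
  then show "mean_curvature ((\<lambda>p. p) \<circ> \<phi>) (axis 3 1) u = metric (\<phi> u) (axis 3 1) (V (\<phi> u))"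
    by (simp add: m3 V X_def)
qed

lemma slice_rotational: "rotational (top_of_set (slice z0)) (\<lambda>p. p)"
  unfolding rotational_def
proof (rule exI[of _ 0], rule exI[of _ 1], intro conjI allI)
  fix t :: real
  have sub: "vertical_rotation 0 1 s p \<in> slice z0" if "p \<in> slice z0" for s p
    using that vertical_rotation_in_H2R[of 1 p 0 s] by (simp add: slice_def vertical_rotation_eq)
  have "p = vertical_rotation 0 1 t (vertical_rotation 0 1 (- t) p)" if p: "p \<in> slice z0" for p
  proof -
    have im: "Im (hpart p) > 0" using p by (simp add: slice_def H2R_def)
    have "hpart p = hyp_rotation 0 1 t (hyp_rotation 0 1 (- t) (hpart p))"
      by (rule hyp_rotation_eqI) (use im in \<open>simp_all add: Im_hyp_rotation_pos disk_hyp_rotation cis_mult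
          mult.assoc[symmetric] del: hpart_sel\<close>)
    then show ?thesis
      using hpoint_hpart[of p] by (simp add: vertical_rotation_eq)
  qed
  then have "slice z0 \<subseteq> vertical_rotation 0 1 t ` slice z0" using sub by blast
  then show "vertical_rotation 0 1 t ` (\<lambda>p. p) ` topspace (top_of_set (slice z0))
      = (\<lambda>p. p) ` topspace (top_of_set (slice z0))"
    using sub by auto
qed simp

theorem theorem3p2:
  shows "(\<forall>z0. p_translator (top_of_set (slice z0)) (\<lambda>p. p)
             \<and> h_translator (top_of_set (slice z0)) (\<lambda>p. p)
             \<and> rotational (top_of_set (slice z0)) (\<lambda>p. p)) \<and>
         (\<forall>(M :: 'm topology) (f :: 'm \<Rightarrow> real^3).
             connected_space M \<and> rotational M f \<and> (p_translator M f \<or> h_translator M f) \<longrightarrow>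
             (\<exists>z0. openin (top_of_set (slice z0)) (f ` topspace M)))"
proof (intro conjI allI impI)
  show "p_translator (top_of_set (slice z0)) (\<lambda>p. p)" "h_translator (top_of_set (slice z0)) (\<lambda>p. p)" for z0
    unfolding p_translator_def h_translator_def by (rule slice_translator; simp add: axis_def)+
  show "rotational (top_of_set (slice z0)) (\<lambda>p. p)" for z0 by (rule slice_rotational)
  fix M :: "'m topology" and f :: "'m \<Rightarrow> real^3"
  assume *: "connected_space M \<and> rotational M f \<and> (p_translator M f \<or> h_translator M f)"
  then obtain x0 y0 where y0: "y0 > 0"
    and rot: "\<And>t. vertical_rotation x0 y0 t ` f ` topspace M = f ` topspace M"
    unfolding rotational_def by metis
  have V: "axis 1 1 = hpoint 1 0" "p $ 1 *\<^sub>R axis 1 1 + p $ 2 *\<^sub>R axis 2 1 = hpoint (hpart p) 0" for p :: "real^3"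
    by (simp_all add: vec_eq_iff forall_3 axis_def)
  from * have M: "connected_space M" by simp
  from * have "p_translator M f \<or> h_translator M f" by simp
  then show "\<exists>z0. openin (top_of_set (slice z0)) (f ` topspace M)"
    unfolding p_translator_def h_translator_def
  proof
    assume "translator (\<lambda>p. axis 1 1) M f"
    then show ?thesis
      by (rule rotational_translator_in_slice[OF M _ y0 rot V(1) parabolic_rotates_nontrivially[OF y0]])
  next
    assume "translator (\<lambda>p. p $ 1 *\<^sub>R axis 1 1 + p $ 2 *\<^sub>R axis 2 1) M f"
    then show ?thesis
      by (rule rotational_translator_in_slice[OF M _ y0 rot V(2) hyperbolic_rotates_nontrivially[OF y0]])
  qed
qed

end
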